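(* Let $\theta\in(0,\theta_* )$ with $\theta_*=\sqrt{\alpha_*/\alpha^*}$, set $\mu_\theta=1-\frac{\alpha^*}{\alpha_*}\theta^2>0$, and let $\mu\in(0,\mu_\theta]$ be fixed. Let $\rho=\sqrt{1-\frac{\alpha_*}{\alpha^*}\theta^2}$ and let $\{\Lambda_n,u_n\}_{n\ge0}$ be the sequence generated by the adaptive algorithm ADFOUR. If $u\in\mathcal A^s_B$ for some $s>0$, then $$|\Lambda_n|\le C_*\,\|u-u_n\|^{-d/s}\,\|u\|_{\mathcal A^s_B}^{d/s}\qquad\forall\,n\ge0,$$ where (for fixed $d$ and $s$) the constant $C_*$ depends only on $\alpha_*$, $\mu$ and $\rho$.
   Context: Let $d\ge1$, $\Omega=(0,2\pi)^d$, $\phi_k(x)=(2\pi)^{-d/2}e^{ik\cdot x}$ for $k\in\mathbb Z^d$, $\hat v_k=(v,\phi_k)_{L^2(\Omega)}$. $V=H^1_p(\Omega)$: $H^1$ functions $2\pi$-periodic in each direction, norm $\|v\|^2=\sum_k(1+|k|^2)|\hat v_k|^2$ ($|k|$ Euclidean). $H^{-1}_p(\Omega)$ is its (anti)dual, $\hat f_k=\langle f,\phi_k\rangle$, $\|f\|^2=\sum_k(1+|k|^2)^{-1}|\hat f_k|^2$ (same symbol for both norms). For $\Lambda\subset\mathbb Z^d$, $P_\Lambda$ keeps only the Fourier coefficients with index in $\Lambda$; $V_\Lambda=\mathrm{span}\{\phi_k:k\in\Lambda\}$; $|\Lambda|$ is the cardinality. $Lu=-\nabla\cdot(\nu\nabla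 u)+\sigma u$ with sufficiently smooth real ($2\pi$-periodic) coefficients, $0<\nu_*\le\nu\le\nu^*<\infty$, $0<\sigma_*\le\sigma\le\sigma^*<\infty$; $\alpha_*=\min(\nu_*,\sigma_* )$, $\alpha^*=\max(\nu^*,\sigma^* )$; $a(u,v)=\int_\Omega\nu\nabla u\cdot\nabla\bar v+\int_\Omega\sigma u\bar v$; $f\in H^{-1}_p(\Omega)$; $u\in V$ solves $a(u,v)=\langle f,v\rangle$ for all $v\in V$. For finite $\Lambda$, $u_\Lambda\in V_\Lambda$ solves $a(u_\Lambda,v)=\langle f,v\rangle$ for all $v\in V_\Lambda$. Residual: $r(w)=f-Lw$. DÖRFLER$(r,\theta)$ returns a finite set $\Lambda^*\subset\mathbb Z^d$ of minimal cardinality with $\|P_{\Lambda^*}r\|\ge\theta\|r\|$. Algorithm ADFOUR$(\theta,tol)$, $tol\in[0,1)$: set $\Lambda_0=\emptyset$, $u_0=0$, $r_0=f$. For $n=0,1,2,\dots$: $\partial\Lambda_n=$ DÖRFLER$(r_n,\theta)$; $\Lambda_{n+1}=\Lambda_n\cup\partial\Lambda_n$; $u_{n+1}=u_{\Lambda_{n+1}}$; $r_{n+1}=r(u_{n+1})$; continue while $\|r_{n+1}\|>tol$. $E_N(v)=\inf_{|\Lambda|=N}\|v-P_\Lambda v\|$. Algebraic class: $\mathcal A^s_B=\{v\in V:\ \|v\|_{\mathcal A^s_B}:=\|v\|+\sup_{N\ge1}E_N(v)N^{s/d}<\infty\}$. If $u_n=u$ the right-hand side of the bound is read as $+\infty$.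 *)

theory Defs
  imports "HOL-Analysis.Analysis"
begin

text \<open>
  The dimension \<open>d\<close> is \<open>CARD('d)\<close>. Elements of the function spaces are \<open>2\<pi>\<close>-periodic functions on
  the whole of \<open>real^'d\<close>, not equivalence classes: all norms, integrals and functionals below only
  depend on the values almost everywhere in \<open>\<Omega>\<close>.
\<close>

definition Omega :: "(real^'d) set" where
  "Omega = box 0 (\<chi> j. 2 * pi)"

definition periodic :: "(real^'d \<Rightarrow> 'b) \<Rightarrow> bool" where
  "periodic v \<longleftrightarrow> (\<forall>x j. v (x + axis j (2 * pi)) = v x)"

definition pderiv_at :: "'d \<Rightarrow> (real^'d \<Rightarrow> 'b::real_normed_vector) \<Rightarrow> real^'d \<Rightarrow> 'b" where
  "pderiv_at j v x = frechet_derivative v (at x) (axis j 1)"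

primrec Ck :: "nat \<Rightarrow> (real^'d \<Rightarrow> 'b::real_normed_vector) \<Rightarrow> bool" where
  "Ck 0 v \<longleftrightarrow> continuous_on UNIV v"
| "Ck (Suc m) v \<longleftrightarrow> v differentiable_on UNIV \<and> (\<forall>j. Ck m (pderiv_at j v))"

definition L2p :: "(real^'d \<Rightarrow> complex) set" where
  "L2p = {v. periodic v \<and> v \<in> borel_measurable (lebesgue_on Omega)
             \<and> integrable (lebesgue_on Omega) (\<lambda>x. (cmod (v x))\<^sup>2)}"

text \<open>
  Testing against all smooth periodic functions (not only those with compact support in \<open>\<Omega>\<close>) makes
  \<open>g\<close> the distributional derivative of \<open>v\<close> on the torus. Thus membership in \<open>H1p\<close> includes the
  matching of the traces of \<open>v\<close> on opposite faces of \<open>\<Omega>\<close>.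
\<close>
definition has_weak_pderiv :: "'d \<Rightarrow> (real^'d \<Rightarrow> complex) \<Rightarrow> (real^'d \<Rightarrow> complex) \<Rightarrow> bool" where
  "has_weak_pderiv j v g \<longleftrightarrow>
     (\<forall>\<psi>::real^'d \<Rightarrow> complex. periodic \<psi> \<and> (\<forall>m. Ck m \<psi>) \<longrightarrow>
        (LINT x|lebesgue_on Omega. v x * pderiv_at j \<psi> x)
          = - (LINT x|lebesgue_on Omega. g x * \<psi> x))"

definition H1p :: "(real^'d \<Rightarrow> complex) set" where
  "H1p = {v \<in> L2p. \<forall>j. \<exists>g\<in>L2p. has_weak_pderiv j v g}"

text \<open>The weak derivative is unique almost everywhere, so the choice of \<open>g\<close> is immaterial.\<close>
definition weak_pderiv :: "'d \<Rightarrow> (real^'d \<Rightarrow> complex) \<Rightarrow> real^'d \<Rightarrow> complex" where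
  "weak_pderiv j v = (SOME g. g \<in> L2p \<and> has_weak_pderiv j v g)"

definition phi :: "int^'d \<Rightarrow> real^'d \<Rightarrow> complex" where
  "phi k x = of_real ((2 * pi) powr (- real CARD('d) / 2))
               * exp (\<i> * of_real (\<Sum>j\<in>UNIV. of_int (k $ j) * x $ j))"

definition fcoeff :: "(real^'d \<Rightarrow> complex) \<Rightarrow> int^'d \<Rightarrow> complex" where
  "fcoeff v k = (LINT x|lebesgue_on Omega. v x * cnj (phi k x))"

text \<open>\<open>1 + |k|\<^sup>2\<close> for the Euclidean norm of \<open>k\<close>.\<close>
definition weight :: "int^'d \<Rightarrow> real" where
  "weight k = 1 + (\<Sum>j\<in>UNIV. (of_int (k $ j))\<^sup>2)"

definition H1_norm :: "(real^'d \<Rightarrow> complex) \<Rightarrow> real" where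
  "H1_norm v = sqrt (\<Sum>\<^sub>\<infinity>k. weight k * (cmod (fcoeff v k))\<^sup>2)"

text \<open>
  The antidual of \<open>H1p\<close>: the duality pairing of \<open>f\<close> and \<open>v\<close> is \<open>f v\<close>, antilinear in \<open>v\<close>, and the
  Fourier coefficients of \<open>f\<close> are \<open>f (phi k)\<close>. Values of \<open>f\<close> outside \<open>H1p\<close> play no role.
\<close>
definition Hm1p :: "((real^'d \<Rightarrow> complex) \<Rightarrow> complex) set" where
  "Hm1p = {f. (\<forall>v\<in>H1p. \<forall>w\<in>H1p. f (\<lambda>x. v x + w x) = f v + f w)
             \<and> (\<forall>c. \<forall>v\<in>H1p. f (\<lambda>x. c * v x) = cnj c * f v)
             \<and> (\<exists>B. \<forall>v\<in>H1p. cmod (f v) \<le> B * H1_norm v)}"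

definition Hm1_norm :: "((real^'d \<Rightarrow> complex) \<Rightarrow> complex) \<Rightarrow> real" where
  "Hm1_norm f = sqrt (\<Sum>\<^sub>\<infinity>k. (cmod (f (phi k)))\<^sup>2 / weight k)"

text \<open>
  The projections onto the Fourier modes in \<open>\<Lambda>\<close>, on functions and on functionals. They are only
  used for finite \<open>\<Lambda>\<close> (for infinite \<open>\<Lambda>\<close> the sums would be 0 by convention).
\<close>
definition proj :: "(int^'d) set \<Rightarrow> (real^'d \<Rightarrow> complex) \<Rightarrow> real^'d \<Rightarrow> complex" where
  "proj \<Lambda> v x = (\<Sum>k\<in>\<Lambda>. fcoeff v k * phi k x)"

definition dual_proj ::
  "(int^'d) set \<Rightarrow> ((real^'d \<Rightarrow> complex) \<Rightarrow> complex) \<Rightarrow> (real^'d \<Rightarrow> complex) \<Rightarrow> complex" where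
  "dual_proj \<Lambda> f v = (\<Sum>k\<in>\<Lambda>. f (phi k) * cnj (fcoeff v k))"

definition V_span :: "(int^'d) set \<Rightarrow> (real^'d \<Rightarrow> complex) set" where
  "V_span \<Lambda> = {v. \<exists>F c. finite F \<and> F \<subseteq> \<Lambda> \<and> v = (\<lambda>x. \<Sum>k\<in>F. c k * phi k x)}"

text \<open>A sufficiently smooth periodic coefficient is taken to be one of class \<open>C\<^sup>1\<close>.\<close>
definition coefficient :: "(real^'d \<Rightarrow> real) \<Rightarrow> real \<Rightarrow> real \<Rightarrow> bool" where
  "coefficient c lo hi \<longleftrightarrow> periodic c \<and> Ck 1 c \<and> 0 < lo \<and> (\<forall>x. lo \<le> c x \<and> c x \<le> hi)"

definition form_a :: "(real^'d \<Rightarrow> real) \<Rightarrow> (real^'d \<Rightarrow> real)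
    \<Rightarrow> (real^'d \<Rightarrow> complex) \<Rightarrow> (real^'d \<Rightarrow> complex) \<Rightarrow> complex" where
  "form_a \<nu> \<sigma> u v =
     (LINT x|lebesgue_on Omega.
        of_real (\<nu> x) * (\<Sum>j\<in>UNIV. weak_pderiv j u x * cnj (weak_pderiv j v x)))
     + (LINT x|lebesgue_on Omega. of_real (\<sigma> x) * u x * cnj (v x))"

text \<open>
  \<open>L w\<close> is the functional \<open>form_a \<nu> \<sigma> w\<close>, the weak form of \<open>-div (\<nu> grad w) + \<sigma> w\<close>.
\<close>
definition residual :: "(real^'d \<Rightarrow> real) \<Rightarrow> (real^'d \<Rightarrow> real)
    \<Rightarrow> ((real^'d \<Rightarrow> complex) \<Rightarrow> complex) \<Rightarrow> (real^'d \<Rightarrow> complex)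
    \<Rightarrow> (real^'d \<Rightarrow> complex) \<Rightarrow> complex" where
  "residual \<nu> \<sigma> f w = (\<lambda>v. f v - form_a \<nu> \<sigma> w v)"

definition solution :: "(real^'d \<Rightarrow> real) \<Rightarrow> (real^'d \<Rightarrow> real)
    \<Rightarrow> ((real^'d \<Rightarrow> complex) \<Rightarrow> complex) \<Rightarrow> (real^'d \<Rightarrow> complex) \<Rightarrow> bool" where
  "solution \<nu> \<sigma> f u \<longleftrightarrow> u \<in> H1p \<and> (\<forall>v\<in>H1p. form_a \<nu> \<sigma> u v = f v)"

definition galerkin :: "(real^'d \<Rightarrow> real) \<Rightarrow> (real^'d \<Rightarrow> real)
    \<Rightarrow> ((real^'d \<Rightarrow> complex) \<Rightarrow> complex) \<Rightarrow> (int^'d) set \<Rightarrow> (real^'d \<Rightarrow> complex) \<Rightarrow> bool" where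
  "galerkin \<nu> \<sigma> f \<Lambda> w \<longleftrightarrow> w \<in> V_span \<Lambda> \<and> (\<forall>v\<in>V_span \<Lambda>. form_a \<nu> \<sigma> w v = f v)"

text \<open>A set of minimal cardinality need not be unique: \<open>\<Lambda>\<close> is one that may be returned.\<close>
definition doerfler ::
  "((real^'d \<Rightarrow> complex) \<Rightarrow> complex) \<Rightarrow> real \<Rightarrow> (int^'d) set \<Rightarrow> bool" where
  "doerfler r \<theta> \<Lambda> \<longleftrightarrow>
     finite \<Lambda> \<and> Hm1_norm (dual_proj \<Lambda> r) \<ge> \<theta> * Hm1_norm r
     \<and> (\<forall>\<Lambda>'. finite \<Lambda>' \<and> Hm1_norm (dual_proj \<Lambda>' r) \<ge> \<theta> * Hm1_norm r \<longrightarrow> card \<Lambda> \<le> card \<Lambda>')"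

text \<open>
  The sequences \<open>\<Lambda>\<close>, \<open>w\<close>, \<open>r\<close> are, up to and including index \<open>N\<close>, iterates produced by the algorithm,
  i.e. it has not stopped before computing iterate \<open>N\<close>. The stopping test is made only after an
  iterate has been computed, so iteration 0 is always carried out.
\<close>
definition adfour :: "(real^'d \<Rightarrow> real) \<Rightarrow> (real^'d \<Rightarrow> real)
    \<Rightarrow> ((real^'d \<Rightarrow> complex) \<Rightarrow> complex) \<Rightarrow> real \<Rightarrow> real
    \<Rightarrow> (nat \<Rightarrow> (int^'d) set) \<Rightarrow> (nat \<Rightarrow> real^'d \<Rightarrow> complex)
    \<Rightarrow> (nat \<Rightarrow> (real^'d \<Rightarrow> complex) \<Rightarrow> complex) \<Rightarrow> nat \<Rightarrow> bool" where
  "adfour \<nu> \<sigma> f \<theta> tol \<Lambda> w r N \<longleftrightarrow>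
     \<Lambda> 0 = {} \<and> w 0 = (\<lambda>x. 0) \<and> r 0 = f
     \<and> (\<forall>n<N. (n > 0 \<longrightarrow> Hm1_norm (r n) > tol)
          \<and> (\<exists>D. doerfler (r n) \<theta> D \<and> \<Lambda> (Suc n) = \<Lambda> n \<union> D)
          \<and> galerkin \<nu> \<sigma> f (\<Lambda> (Suc n)) (w (Suc n))
          \<and> r (Suc n) = residual \<nu> \<sigma> f (w (Suc n)))"

definition best_error :: "nat \<Rightarrow> (real^'d \<Rightarrow> complex) \<Rightarrow> real" where
  "best_error N v = (INF \<Lambda>\<in>{\<Lambda>. finite \<Lambda> \<and> card \<Lambda> = N}. H1_norm (\<lambda>x. v x - proj \<Lambda> v x))"

definition AsB :: "real \<Rightarrow> (real^'d \<Rightarrow> complex) set" where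
  "AsB s = {v \<in> H1p. bdd_above ((\<lambda>N. best_error N v * real N powr (s / real CARD('d))) ` {1..})}"

definition AsB_norm :: "real \<Rightarrow> (real^'d \<Rightarrow> complex) \<Rightarrow> real" where
  "AsB_norm s v = H1_norm v + (SUP N\<in>{1..}. best_error N v * real N powr (s / real CARD('d)))"

end

theory Submission
  imports Defs
begin

text \<open>
  Write \<open>e\<^sub>n = u - u\<^sub>n\<close> and let the energy of \<open>v\<close> be \<open>a(v,v)\<close>, which lies between \<open>\<alpha>lo \<parallel>v\<parallel>\<^sup>2\<close> and
  \<open>\<alpha>up \<parallel>v\<parallel>\<^sup>2\<close>. The residual of \<open>u\<^sub>n\<close> is the functional \<open>a(e\<^sub>n, \<cdot>)\<close>, and its dual norm is equivalent
  to the energy norm of \<open>e\<^sub>n\<close>. Two facts about a single step give the theorem.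
  
  First, the energy decays geometrically (\<open>energy_contraction\<close>): the correction \<open>u\<^sub>n\<^sub>+\<^sub>1 - u\<^sub>n\<close> is
  \<open>a\<close>-orthogonal to \<open>e\<^sub>n\<^sub>+\<^sub>1\<close>, and it has the same residual coefficients as \<open>e\<^sub>n\<close> on the marked modes,
  which carry the fraction \<open>\<theta>\<close> of the residual. Hence the energy drops by the factor \<open>\<rho>\<^sup>2\<close>.
  
  Second, marking is economical (\<open>optimal_marking\<close>): if some element of the span of the modes in
  \<open>\<Lambda>\<^sub>n \<union> U\<close> approximates \<open>u\<close> with energy at most \<open>\<mu>\<close> times that of \<open>e\<^sub>n\<close>, then \<open>U\<close> passes the bulk
  criterion, so a minimal marked set has at most as many elements as \<open>U\<close>. By the definition of the
  approximation class there is such a \<open>U\<close>, with \<open>u\<close> approximated by its own truncation to \<open>U\<close>, whose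
  cardinality is of order \<open>(\<parallel>u\<parallel>\<^sub>A / \<parallel>e\<^sub>n\<parallel>)\<close> to the power \<open>d/s\<close> (\<open>AsB_approximation\<close>).
  
  Adding up these cardinalities, the geometric decay makes the last term dominate the sum
  (\<open>cardinality_bound\<close>). The ratio \<open>\<alpha>lo/\<alpha>up\<close> enters the resulting constant, but it is larger than
  \<open>sqrt (1 - \<rho>\<^sup>2)\<close> because \<open>1 - \<rho>\<^sup>2 = \<theta>\<^sup>2 \<alpha>lo/\<alpha>up\<close> and \<open>\<theta>\<^sup>2 < \<alpha>lo/\<alpha>up\<close>; this removes \<open>\<alpha>up\<close>.
  
  Since the Sobolev norm is defined through Fourier coefficients and the form through integrals of
  weak derivatives, the comparison of the two needs Parseval's identity in several variables
  (\<open>parseval\<close>). It follows from the density of trigonometric polynomials in \<open>L\<^sup>2\<close>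
  (\<open>L2_trig_approximable\<close>). The same completeness makes weak derivatives unique almost everywhere, so
  that the form is sesquilinear, and shows that \<open>\<parallel>u - u\<^sub>n\<parallel> > 0\<close> as soon as \<open>u\<^sub>n\<close> and \<open>u\<close> are not equal
  almost everywhere.
\<close>

section \<open>Integrals of periodic functions over the cube\<close>

definition two_pi :: "real^'d" where "two_pi = (\<chi> j. 2 * pi)"

lemma Omega_eq: "Omega = box 0 (two_pi :: real^'d)"
  by (simp add: Omega_def two_pi_def)

lemma axis_component: "axis j t $ i = (if i = j then t else 0)"
  by (simp add: axis_def)

lemma integrable_lebesgue_on_Omega:
  fixes g :: "real^'d \<Rightarrow> complex"
  assumes "continuous_on UNIV g"
  shows "integrable (lebesgue_on Omega) g"
proof -
  have "g absolutely_integrable_on cbox 0 two_pi"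
    by (intro absolutely_integrable_continuous continuous_on_subset[OF assms]) auto
  then have "g absolutely_integrable_on Omega"
    unfolding Omega_eq by (rule set_integrable_subset) (auto simp: box_subset_cbox)
  then show ?thesis
    by (simp add: absolutely_integrable_imp_integrable Omega_eq)
qed

lemma lebesgue_on_Omega_eq_integral:
  fixes g :: "real^'d \<Rightarrow> complex"
  assumes "continuous_on UNIV g"
  shows "(LINT x|lebesgue_on Omega. g x) = integral (cbox 0 two_pi) g"
proof -
  have "(LINT x|lebesgue_on Omega. g x) = integral Omega g"
    by (intro lebesgue_integral_eq_integral integrable_lebesgue_on_Omega assms) (simp add: Omega_eq)
  also have "\<dots> = integral (cbox 0 two_pi) g"
    unfolding Omega_eq by (rule integral_open_interval)
  finally show ?thesis .
qed

text \<open>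
  The translated cube is cut at the face of the original one. The slab that sticks out is moved back
  by a full period, which does not change the integrand, and fills the gap left by the translation.
\<close>
lemma integral_periodic_shift:
  fixes g :: "real^'d \<Rightarrow> complex"
  assumes per: "periodic g" and cont: "continuous_on UNIV g" and t: "0 \<le> t" "t \<le> 2 * pi"
  shows "integral (cbox 0 two_pi) (\<lambda>x. g (x + axis j t)) = integral (cbox 0 two_pi) g"
proof -
  define Q1 :: "(real^'d) set" where "Q1 = cbox 0 (\<chi> i. if i = j then t else 2 * pi)"
  define Q2 :: "(real^'d) set" where "Q2 = cbox (axis j t) two_pi"
  define Q3 :: "(real^'d) set" where "Q3 = cbox (axis j (2*pi)) (two_pi + axis j t)"
  have int: "g integrable_on cbox a b" for a b
    by (intro integrable_continuous continuous_on_subset[OF cont]) auto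
  have s1: "cbox 0 two_pi \<inter> {x. x \<bullet> axis j 1 \<le> t} = Q1"
    using t unfolding Q1_def
    by (auto simp: mem_box_cart inner_axis two_pi_def split: if_splits) (smt (verit))+
  have s2: "cbox 0 two_pi \<inter> {x. x \<bullet> axis j 1 \<ge> t} = Q2"
    using t unfolding Q2_def
    by (auto simp: mem_box_cart inner_axis two_pi_def axis_component split: if_splits) (smt (verit))+
  have s3: "cbox (axis j t) (two_pi + axis j t) \<inter> {x. x \<bullet> axis j 1 \<le> 2*pi} = Q2"
    using t unfolding Q2_def
    by (auto simp: mem_box_cart inner_axis two_pi_def axis_component split: if_splits) (smt (verit))+
  have s4: "cbox (axis j t) (two_pi + axis j t) \<inter> {x. x \<bullet> axis j 1 \<ge> 2*pi} = Q3"
    using t unfolding Q3_def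
    by (auto simp: mem_box_cart inner_axis two_pi_def axis_component split: if_splits) (smt (verit))+
  have "integral (cbox 0 two_pi) (\<lambda>x. g (x + axis j t)) = integral (cbox (axis j t) (two_pi + axis j t)) g"
    using integral_shift_cbox_plus[of 0 two_pi g "axis j t"] by (simp add: o_def add.commute)
  also have "\<dots> = integral Q2 g + integral Q3 g"
    by (subst integral_split[OF int, of "axis j 1" _ _ "2*pi"]) (simp_all only: s3 s4, simp add: axis_in_Basis_iff)
  also have "Q3 = cbox (0 + axis j (2*pi)) ((\<chi> i. if i = j then t else 2 * pi) + axis j (2*pi))"
    unfolding Q3_def by (rule arg_cong2[where f=cbox]) (auto simp: vec_eq_iff axis_component two_pi_def)
  also have "integral \<dots> g = integral Q1 (g \<circ> (+) (axis j (2*pi)))"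
    unfolding Q1_def by (rule integral_shift_cbox_plus[symmetric])
  also have "g \<circ> (+) (axis j (2*pi)) = g"
    using per by (auto simp: periodic_def fun_eq_iff add.commute)
  also have "integral Q2 g + integral Q1 g = integral (cbox 0 two_pi) g"
    by (subst integral_split[OF int, of "axis j 1" 0 two_pi "t"]) (simp_all only: s1 s2, simp_all add: axis_in_Basis_iff)
  finally show ?thesis .
qed

lemma has_vector_derivative_along_axis:
  fixes v :: "real^'d \<Rightarrow> complex"
  assumes "v differentiable_on UNIV"
  shows "((\<lambda>t. v (x + axis j t)) has_vector_derivative pderiv_at j v (x + axis j t)) (at t within S)"
proof -
  have d: "(v has_derivative frechet_derivative v (at (x + axis j t))) (at (x + axis j t))"
    using assms by (simp add: frechet_derivative_works differentiable_on_def)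
  have ax: "((\<lambda>t. x + axis j t) has_derivative (\<lambda>t. t *\<^sub>R axis j 1)) (at t within S)"
  proof -
    have "(\<lambda>t::real. x + axis j t) = (\<lambda>t. x + t *\<^sub>R axis j 1)"
      by (auto simp: fun_eq_iff vec_eq_iff axis_component)
    then show ?thesis by (auto intro!: derivative_eq_intros)
  qed
  have "linear (frechet_derivative v (at (x + axis j t)))"
    using d has_derivative_linear by blast
  then show ?thesis
    unfolding has_vector_derivative_def
    using has_derivative_compose[OF ax d] by (simp add: pderiv_at_def linear_cmul)
qed

lemma pderiv_at_eqI:
  assumes "(v has_derivative D) (at x)"
  shows "pderiv_at j v x = D (axis j 1)"
  using frechet_derivative_at[OF assms] by (simp add: pderiv_at_def)

text \<open>
  The integral of \<open>h\<close> over the translated cube is constant in the translation, and its derivative at \<open>0\<close>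
  is the integral of \<open>\<partial>\<^sub>j h\<close>. This replaces the divergence theorem on the torus.
\<close>
lemma integral_pderiv_periodic:
  fixes h :: "real^'d \<Rightarrow> complex"
  assumes per: "periodic h" and diff: "h differentiable_on UNIV"
    and cont: "continuous_on UNIV (pderiv_at j h)"
  shows "(LINT x|lebesgue_on Omega. pderiv_at j h x) = 0"
proof -
  have conth: "continuous_on UNIV h"
    using diff by (rule differentiable_imp_continuous_on)
  define F where "F = (\<lambda>t. integral (cbox 0 two_pi) (\<lambda>x. h (x + axis j t)))"
  have ax: "continuous_on S (\<lambda>t::real. axis j t :: real^'d)" for S
  proof -
    have "(\<lambda>t::real. axis j t :: real^'d) = (\<lambda>t. t *\<^sub>R axis j 1)"
      by (auto simp: fun_eq_iff vec_eq_iff axis_component)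
    then show ?thesis by (rule ssubst) (intro continuous_intros)
  qed
  have "(F has_vector_derivative integral (cbox 0 two_pi) (\<lambda>x. pderiv_at j h (x + axis j 0))) (at 0 within {0..1})"
    unfolding F_def
  proof (rule leibniz_rule_vector_derivative)
    fix t :: real and x :: "real^'d"
    show "((\<lambda>t. h (x + axis j t)) has_vector_derivative pderiv_at j h (x + axis j t)) (at t within {0..1})"
      by (rule has_vector_derivative_along_axis[OF diff])
    show "(\<lambda>x. h (x + axis j t)) integrable_on cbox 0 two_pi"
      by (intro integrable_continuous continuous_on_compose2[OF conth] continuous_intros) auto
  next
    show "continuous_on ({0..1} \<times> cbox 0 two_pi) (\<lambda>(t, x). pderiv_at j h (x + axis j t))"
      unfolding split_beta
      by (intro continuous_on_compose2[OF cont] continuous_on_compose2[OF ax] continuous_intros) auto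
  qed auto
  moreover have "(F has_vector_derivative 0) (at 0 within {0..1})"
  proof (rule has_vector_derivative_transform)
    show "F t = integral (cbox 0 two_pi) h" if "t \<in> {0..1}" for t
      unfolding F_def using that pi_gt3 by (intro integral_periodic_shift per conth) auto
  qed auto
  ultimately have "integral (cbox 0 two_pi) (\<lambda>x. pderiv_at j h (x + axis j 0)) = 0"
    by (rule vector_derivative_unique_within[rotated]) (simp add: trivial_limit_within islimpt_Icc)
  moreover have "axis j (0::real) = 0" by (simp add: vec_eq_iff axis_component)
  ultimately show ?thesis by (simp add: lebesgue_on_Omega_eq_integral[OF cont])
qed

section \<open>The trigonometric system\<close>

definition phase :: "int^'d \<Rightarrow> real^'d \<Rightarrow> real" where
  "phase k x = (\<Sum>j\<in>UNIV. of_int (k $ j) * x $ j)"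

definition phi_const :: "'d itself \<Rightarrow> real" where
  "phi_const _ = (2 * pi) powr (- real CARD('d) / 2)"

lemma phi_eq: "phi k x = of_real (phi_const TYPE('d)) * cis (phase k (x::real^'d))"
  by (simp add: phi_def phi_const_def phase_def cis_conv_exp)

lemma phi_const_pos: "phi_const TYPE('d::finite) > 0"
  by (simp add: phi_const_def)

lemma phi_const_square: "(phi_const TYPE('d::finite))\<^sup>2 * (2*pi) ^ CARD('d) = 1"
proof -
  have "(phi_const TYPE('d))\<^sup>2 = (2*pi) powr (- real CARD('d))"
    by (simp add: phi_const_def power2_eq_square flip: powr_add)
  moreover have "(2*pi) powr (- real CARD('d)) * (2*pi) powr real CARD('d) = 1"
    by (simp flip: powr_add)
  moreover have "(2*pi) powr real CARD('d) = (2*pi) ^ CARD('d)" by (rule powr_realpow) simp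
  ultimately show ?thesis by (simp only:)
qed

lemma phase_add: "phase (k + l) x = phase k x + phase l x"
  by (simp add: phase_def sum.distrib algebra_simps)

lemma phase_uminus: "phase (- k) x = - phase k x"
  by (simp add: phase_def sum_negf)

lemma phase_zero [simp]: "phase 0 x = 0"
  by (simp add: phase_def)

lemma cnj_phi: "cnj (phi k x) = phi (- k) x"
  by (simp add: phi_eq phase_uminus cis_cnj)

lemma phi_mult: "phi k x * phi l x = of_real (phi_const TYPE('d)) * phi (k + l) (x::real^'d)"
  by (simp add: phi_eq phase_add flip: cis_mult)

lemma norm_phi: "cmod (phi k (x::real^'d)) = phi_const TYPE('d)"
  using phi_const_pos[where 'd='d] by (simp add: phi_eq norm_mult)

lemma phase_add_right: "phase k (x + y) = phase k x + phase k y"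
  by (simp add: phase_def sum.distrib algebra_simps)

lemma phase_axis: "phase k (axis j t) = of_int (k $ j) * t"
  by (simp add: phase_def axis_component if_distrib sum.delta cong: if_cong)

lemma periodic_phi: "periodic (phi k)"
proof -
  have "cis (of_int m * (2 * pi)) = 1" for m
    using cis_multiple_2pi[of "of_int m"] by (simp add: mult.commute)
  then show ?thesis
    by (simp add: periodic_def phi_eq phase_add_right phase_axis flip: cis_mult)
qed

lemma has_derivative_phi:
  "(phi k has_derivative (\<lambda>h. \<i> * of_real (phase k h) * phi k x)) (at x within S)"
proof -
  have "bounded_linear (phase k)"
    unfolding phase_def
    by (intro bounded_linear_sum bounded_linear_const_mult bounded_linear_vec_nth)
  then have "(phase k has_derivative phase k) (at x within S)"
    by (rule bounded_linear_imp_has_derivative)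
  then have "((\<lambda>x. cis (phase k x)) has_derivative (\<lambda>h. phase k h *\<^sub>R (\<i> * cis (phase k x)))) (at x within S)"
    by (auto intro!: derivative_eq_intros)
  from has_derivative_mult_right[OF this, of "of_real (phi_const TYPE('a))"] show ?thesis
    unfolding phi_eq by (simp add: scaleR_conv_of_real mult_ac)
qed

lemma phi_differentiable: "phi k differentiable_on S"
  using has_derivative_phi by (auto simp: differentiable_on_def differentiable_def)

lemma continuous_phi: "continuous_on S (phi k)"
  by (rule differentiable_imp_continuous_on[OF phi_differentiable])

lemma pderiv_phi: "pderiv_at j (phi k) = (\<lambda>x. \<i> * of_int (k $ j) * phi k x)"
  by (auto simp: fun_eq_iff pderiv_at_eqI[OF has_derivative_phi] phase_axis)

lemma pderiv_scaled_phi: "pderiv_at j (\<lambda>x. c * phi k x) = (\<lambda>x. (\<i> * of_int (k $ j) * c) * phi k x)"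
proof
  fix x
  have "((\<lambda>x. c * phi k x) has_derivative (\<lambda>h. c * (\<i> * of_real (phase k h) * phi k x))) (at x)"
    by (auto intro!: derivative_eq_intros has_derivative_phi)
  from pderiv_at_eqI[OF this]
  show "pderiv_at j (\<lambda>x. c * phi k x) x = (\<i> * of_int (k $ j) * c) * phi k x"
    by (simp add: phase_axis)
qed

lemma Ck_phi: "Ck m (\<lambda>x. c * phi k x)"
proof (induction m arbitrary: c)
  case 0
  then show ?case by (auto intro!: continuous_intros continuous_phi)
next
  case (Suc m)
  have "(\<lambda>x. c * phi k x) differentiable_on UNIV"
    by (rule differentiable_on_mult[OF _ phi_differentiable]) simp
  with Suc show ?case by (simp add: pderiv_scaled_phi)
qed

text \<open>
  The product \<open>phi k * \<psi>\<close> is periodic, so its derivative integrates to zero. Hence the classical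
  derivative of \<open>phi k\<close> is also its weak derivative.
\<close>
lemma integral_phi_pderiv:
  assumes per: "periodic \<psi>" and sm: "Ck 1 \<psi>"
  shows "(LINT x|lebesgue_on Omega. phi k x * pderiv_at j \<psi> x)
           = - (LINT x|lebesgue_on Omega. (\<i> * of_int (k $ j) * phi k x) * \<psi> x)"
proof -
  have d: "\<psi> differentiable_on UNIV" and c: "continuous_on UNIV (pderiv_at j \<psi>)"
    using sm by auto
  have c0: "continuous_on UNIV \<psi>" using d by (rule differentiable_imp_continuous_on)
  have pd: "pderiv_at j (\<lambda>x. phi k x * \<psi> x) x
              = phi k x * pderiv_at j \<psi> x + \<i> * of_int (k $ j) * phi k x * \<psi> x" for x
  proof -
    have "(\<psi> has_derivative frechet_derivative \<psi> (at x)) (at x)"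
      using d by (simp add: frechet_derivative_works differentiable_on_def)
    from pderiv_at_eqI[OF has_derivative_mult[OF has_derivative_phi[of k x] this]] show ?thesis by (simp add: pderiv_at_def phase_axis)
  qed
  have "(LINT x|lebesgue_on Omega. pderiv_at j (\<lambda>x. phi k x * \<psi> x) x) = 0"
  proof (rule integral_pderiv_periodic)
    show "periodic (\<lambda>x. phi k x * \<psi> x)" using per periodic_phi[of k] by (simp add: periodic_def)
    show "(\<lambda>x. phi k x * \<psi> x) differentiable_on UNIV"
      by (intro differentiable_on_mult phi_differentiable d)
    show "continuous_on UNIV (pderiv_at j (\<lambda>x. phi k x * \<psi> x))"
      unfolding pd by (intro continuous_intros continuous_phi c c0)
  qed
  then show ?thesis
    unfolding pd
    by (subst (asm) Bochner_Integration.integral_add)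
       (auto intro!: integrable_lebesgue_on_Omega continuous_intros continuous_phi c c0 simp: add_eq_0_iff2)
qed

lemma measure_Omega: "measure lebesgue (Omega :: (real^'d) set) = (2*pi) ^ CARD('d)"
proof -
  have ne: "cbox 0 (two_pi :: real^'d) \<noteq> {}"
    using pi_ge_zero by (auto simp: interval_ne_empty_cart two_pi_def)
  show ?thesis
    using content_cbox_cart[OF ne]
    by (simp add: Omega_eq measure_lborel_box_eq measure_lborel_cbox_eq) (simp add: two_pi_def)
qed

lemma finite_measure_Omega: "finite_measure (lebesgue_on (Omega :: (real^'d) set))"
  by (rule finite_measure_lebesgue_on) (simp add: Omega_eq)

text \<open>
  For \<open>k \<noteq> l\<close> an integration by parts in a coordinate \<open>j\<close> with \<open>k\<^sub>j \<noteq> l\<^sub>j\<close> shows that the integral is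
  annihilated by \<open>k\<^sub>j - l\<^sub>j\<close>.
\<close>
lemma phi_orthonormal:
  fixes k l :: "int^'d"
  shows "(LINT x|lebesgue_on Omega. phi k x * cnj (phi l x)) = (if k = l then 1 else 0)"
proof (cases "k = l")
  case True
  have "phi k x * cnj (phi l x) = of_real ((phi_const TYPE('d))\<^sup>2)" for x
    using norm_phi[of k x] by (simp add: True complex_norm_square[symmetric])
  then have "(LINT x|lebesgue_on Omega. phi k x * cnj (phi l x))
     = measure (lebesgue_on (Omega::(real^'d) set)) (space (lebesgue_on Omega)) *\<^sub>R complex_of_real ((phi_const TYPE('d))\<^sup>2)"
    by simp
  also have "measure (lebesgue_on (Omega::(real^'d) set)) (space (lebesgue_on Omega)) = (2*pi) ^ CARD('d)"
    using measure_Omega[where 'd='d] by (simp add: measure_restrict_space Omega_eq)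
  also have "(2*pi) ^ CARD('d) *\<^sub>R complex_of_real ((phi_const TYPE('d))\<^sup>2) = of_real ((phi_const TYPE('d))\<^sup>2 * (2*pi) ^ CARD('d))"
    by (simp only: scaleR_conv_of_real of_real_mult mult.commute)
  finally show ?thesis
    using True by (simp only: phi_const_square) simp
next
  case False
  then obtain j where j: "k $ j \<noteq> l $ j" by (auto simp: vec_eq_iff)
  have per: "periodic (\<lambda>x. 1 * phi (- l) x)" using periodic_phi[of "-l"] by simp
  have "(LINT x|lebesgue_on Omega. phi k x * (- \<i> * of_int (l $ j) * phi (- l) x))
           = - (LINT x|lebesgue_on Omega. (\<i> * of_int (k $ j) * phi k x) * phi (- l) x)"
    using integral_phi_pderiv[OF per Ck_phi, of k j] by (simp add: pderiv_phi)
  moreover have "(LINT x|lebesgue_on Omega. phi k x * (- \<i> * of_int (l $ j) * phi (- l) x))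
      = - \<i> * of_int (l $ j) * (LINT x|lebesgue_on Omega. phi k x * phi (-l) x)"
    by (subst integral_mult_right_zero[symmetric]) (simp add: mult_ac)
  moreover have "(LINT x|lebesgue_on Omega. (\<i> * of_int (k $ j) * phi k x) * phi (- l) x)
      = \<i> * of_int (k $ j) * (LINT x|lebesgue_on Omega. phi k x * phi (-l) x)"
    by (subst integral_mult_right_zero[symmetric]) (simp add: mult_ac)
  ultimately have "(of_int (l $ j) - of_int (k $ j)) * (LINT x|lebesgue_on Omega. phi k x * phi (-l) x) = 0"
    by (simp add: algebra_simps)
  with j show ?thesis using False by (simp add: cnj_phi)
qed

section \<open>Square-integrable functions\<close>

definition L2 :: "'a measure \<Rightarrow> ('a \<Rightarrow> complex) set" where
  "L2 M = {f \<in> borel_measurable M. integrable M (\<lambda>x. (cmod (f x))\<^sup>2)}"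

text \<open>
  The square of the \<open>L\<^sup>2\<close> seminorm. The square is kept throughout: it is additive in the situations
  that matter (Parseval, energies), and for closure arguments the crude triangle inequality with a
  factor 2 is enough.
\<close>
definition sqint :: "'a measure \<Rightarrow> ('a \<Rightarrow> complex) \<Rightarrow> real" where
  "sqint M f = (LINT x|M. (cmod (f x))\<^sup>2)"

lemma L2_measurable: "f \<in> L2 M \<Longrightarrow> f \<in> borel_measurable M"
  and L2_integrable_square: "f \<in> L2 M \<Longrightarrow> integrable M (\<lambda>x. (cmod (f x))\<^sup>2)"
  by (auto simp: L2_def)

lemma sqint_nonneg: "sqint M f \<ge> 0"
  by (simp add: sqint_def)

lemma cmod_add_square_le: "(cmod (a + b))\<^sup>2 \<le> 2 * (cmod a)\<^sup>2 + 2 * (cmod b)\<^sup>2"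
proof -
  have "(cmod (a + b))\<^sup>2 \<le> (cmod a + cmod b)\<^sup>2"
    by (intro power_mono norm_triangle_ineq) auto
  also have "\<dots> \<le> 2 * (cmod a)\<^sup>2 + 2 * (cmod b)\<^sup>2"
    using zero_le_power2[of "cmod a - cmod b"] by (simp add: power2_eq_square algebra_simps)
  finally show ?thesis .
qed

lemma L2_dominated:
  assumes "f \<in> borel_measurable M" "g \<in> L2 M" "\<And>x. x \<in> space M \<Longrightarrow> cmod (f x) \<le> c * cmod (g x)"
  shows "f \<in> L2 M"
proof -
  have [measurable]: "f \<in> borel_measurable M" by fact
  have "integrable M (\<lambda>x. (cmod (f x))\<^sup>2)"
  proof (rule Bochner_Integration.integrable_bound)
    show "integrable M (\<lambda>x. c\<^sup>2 * (cmod (g x))\<^sup>2)"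
      using assms(2) by (simp add: L2_def)
    show "AE x in M. norm ((cmod (f x))\<^sup>2) \<le> norm (c\<^sup>2 * (cmod (g x))\<^sup>2)"
      using power_mono[OF assms(3), of _ 2] by (auto simp: power_mult_distrib intro!: AE_I2)
  qed measurable
  with assms show ?thesis by (simp add: L2_def)
qed

lemma L2_add: "f \<in> L2 M \<Longrightarrow> g \<in> L2 M \<Longrightarrow> (\<lambda>x. f x + g x) \<in> L2 M"
  unfolding L2_def
proof safe
  assume [measurable]: "f \<in> borel_measurable M" "g \<in> borel_measurable M"
    and i: "integrable M (\<lambda>x. (cmod (f x))\<^sup>2)" "integrable M (\<lambda>x. (cmod (g x))\<^sup>2)"
  show "integrable M (\<lambda>x. (cmod (f x + g x))\<^sup>2)"
  proof (rule Bochner_Integration.integrable_bound)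
    show "integrable M (\<lambda>x. 2 * (cmod (f x))\<^sup>2 + 2 * (cmod (g x))\<^sup>2)" using i by auto
  qed (auto intro!: AE_I2 order_trans[OF cmod_add_square_le])
qed measurable

lemma sqint_add_le:
  assumes "f \<in> L2 M" "g \<in> L2 M"
  shows "sqint M (\<lambda>x. f x + g x) \<le> 2 * sqint M f + 2 * sqint M g"
proof -
  have "sqint M (\<lambda>x. f x + g x) \<le> (LINT x|M. 2 * (cmod (f x))\<^sup>2 + 2 * (cmod (g x))\<^sup>2)"
    unfolding sqint_def
    using assms L2_add[OF assms] by (intro integral_mono) (auto simp: L2_def cmod_add_square_le)
  also have "\<dots> = 2 * sqint M f + 2 * sqint M g"
    using assms by (subst Bochner_Integration.integral_add) (auto simp: L2_def sqint_def)
  finally show ?thesis .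
qed

lemma L2_scale: "f \<in> L2 M \<Longrightarrow> (\<lambda>x. c * f x) \<in> L2 M"
  by (auto simp: L2_def norm_mult power_mult_distrib)

lemma sqint_scale: "sqint M (\<lambda>x. c * f x) = (cmod c)\<^sup>2 * sqint M f"
  by (auto simp: sqint_def norm_mult power_mult_distrib)

lemma L2_diff: "f \<in> L2 M \<Longrightarrow> g \<in> L2 M \<Longrightarrow> (\<lambda>x. f x - g x) \<in> L2 M"
  using L2_add[OF _ L2_scale[of g M "-1"], of f] by simp

lemma L2_integrable_mult:
  assumes "f \<in> L2 M" "g \<in> L2 M"
  shows "integrable M (\<lambda>x. f x * cnj (g x))"
proof (rule Bochner_Integration.integrable_bound)
  show "integrable M (\<lambda>x. (cmod (f x))\<^sup>2 + (cmod (g x))\<^sup>2)" using assms by (auto simp: L2_def)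
  show "(\<lambda>x. f x * cnj (g x)) \<in> borel_measurable M"
    using borel_measurable_times[OF L2_measurable[OF assms(1)]
        borel_measurable_continuous_on[OF _ L2_measurable[OF assms(2)], of cnj]]
    by (simp add: continuous_on_cnj)
  have "cmod a * cmod b \<le> (cmod a)\<^sup>2 + (cmod b)\<^sup>2" for a b
    using sum_squares_bound[of "cmod a" "cmod b"] mult_nonneg_nonneg[OF norm_ge_zero[of a] norm_ge_zero[of b]]
    unfolding mult.assoc by linarith
  then show "AE x in M. norm (f x * cnj (g x)) \<le> norm ((cmod (f x))\<^sup>2 + (cmod (g x))\<^sup>2)"
    by (auto intro!: AE_I2 simp: norm_mult)
qed

lemma L2_cong_AE:
  assumes "f \<in> L2 M" "AE x in M. f x = g x" "g \<in> borel_measurable M"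
  shows "g \<in> L2 M" "sqint M (\<lambda>x. f x - g x) = 0"
proof -
  have [measurable]: "g \<in> borel_measurable M" "f \<in> borel_measurable M" using assms by (auto simp: L2_def)
  have "integrable M (\<lambda>x. (cmod (f x))\<^sup>2) \<longleftrightarrow> integrable M (\<lambda>x. (cmod (g x))\<^sup>2)"
    using assms(2) by (intro integrable_cong_AE) auto
  then show "g \<in> L2 M" using assms by (simp add: L2_def)
  have "sqint M (\<lambda>x. f x - g x) = (LINT x|M. 0)"
    unfolding sqint_def using assms(2) by (intro integral_cong_AE) auto
  then show "sqint M (\<lambda>x. f x - g x) = 0" by simp
qed

lemma L2_bounded:
  assumes "finite_measure M" "f \<in> borel_measurable M" "\<And>x. x \<in> space M \<Longrightarrow> cmod (f x) \<le> B"
  shows "f \<in> L2 M"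
proof -
  have "(\<lambda>x. 1) \<in> L2 M" using assms(1) by (simp add: L2_def finite_measure.integrable_const)
  from L2_dominated[OF assms(2) this, of B] assms(3) show ?thesis by simp
qed

text \<open>
  Dominated convergence in mean square; it turns the pointwise limits below into \<open>L\<^sup>2\<close> limits.
\<close>
lemma sqint_dominated_convergence:
  assumes "\<And>n. s n \<in> borel_measurable M" "f \<in> borel_measurable M" "g \<in> L2 M"
    and "\<And>x. x \<in> space M \<Longrightarrow> (\<lambda>n. s n x) \<longlonglongrightarrow> f x"
    and bd: "\<And>n x. x \<in> space M \<Longrightarrow> cmod (s n x - f x) \<le> cmod (g x)"
  shows "(\<lambda>n. sqint M (\<lambda>x. f x - s n x)) \<longlonglongrightarrow> 0"
proof -
  have [measurable]: "s n \<in> borel_measurable M" "f \<in> borel_measurable M" for n using assms by auto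
  have "(\<lambda>n. LINT x|M. (cmod (f x - s n x))\<^sup>2) \<longlonglongrightarrow> (LINT x|M. 0)"
  proof (rule integral_dominated_convergence)
    show "integrable M (\<lambda>x. (cmod (g x))\<^sup>2)" using assms by (simp add: L2_def)
    show "AE x in M. (\<lambda>n. (cmod (f x - s n x))\<^sup>2) \<longlonglongrightarrow> 0"
    proof (rule AE_I2)
      fix x assume "x \<in> space M"
      then have "(\<lambda>n. (cmod (f x - s n x))\<^sup>2) \<longlonglongrightarrow> (cmod (f x - f x))\<^sup>2"
        by (intro tendsto_intros assms)
      then show "(\<lambda>n. (cmod (f x - s n x))\<^sup>2) \<longlonglongrightarrow> 0" by simp
    qed
    show "AE x in M. norm ((cmod (f x - s n x))\<^sup>2) \<le> (cmod (g x))\<^sup>2" for n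
      using bd by (auto intro!: AE_I2 power_mono simp: norm_minus_commute)
  qed measurable
  then show ?thesis by (simp add: sqint_def)
qed

section \<open>Trigonometric polynomials\<close>

lemma V_spanI: "finite F \<Longrightarrow> F \<subseteq> \<Lambda> \<Longrightarrow> (\<lambda>x. \<Sum>k\<in>F. c k * phi k x) \<in> V_span \<Lambda>"
  unfolding V_span_def by auto

lemma V_spanE:
  assumes "v \<in> V_span \<Lambda>"
  obtains F c where "finite F" "F \<subseteq> \<Lambda>" "v = (\<lambda>x. \<Sum>k\<in>F. c k * phi k x)"
  using assms unfolding V_span_def by auto

lemma V_span_zero: "(\<lambda>x. 0) \<in> V_span \<Lambda>"
  unfolding V_span_def by (auto intro!: exI[of _ "{}"])

lemma V_span_scaled_phi: "k \<in> \<Lambda> \<Longrightarrow> (\<lambda>x. c * phi k x) \<in> V_span \<Lambda>"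
  unfolding V_span_def by (auto intro!: exI[of _ "{k}"] exI[of _ "\<lambda>_. c"])

lemma V_span_phi: "k \<in> \<Lambda> \<Longrightarrow> phi k \<in> V_span \<Lambda>"
  using V_span_scaled_phi[of k \<Lambda> 1] by simp

lemma V_span_add:
  assumes "v \<in> V_span \<Lambda>" "w \<in> V_span \<Lambda>"
  shows "(\<lambda>x. v x + w x) \<in> V_span \<Lambda>"
proof -
  obtain F c where F: "finite F" "F \<subseteq> \<Lambda>" "v = (\<lambda>x. \<Sum>k\<in>F. c k * phi k x)" using assms(1) by (rule V_spanE)
  obtain G e where G: "finite G" "G \<subseteq> \<Lambda>" "w = (\<lambda>x. \<Sum>k\<in>G. e k * phi k x)" using assms(2) by (rule V_spanE)
  have 1: "v x = (\<Sum>k\<in>F \<union> G. (if k \<in> F then c k else 0) * phi k x)" for x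
    unfolding F(3) using F(1) G(1) by (intro sum.mono_neutral_cong_left) auto
  have 2: "w x = (\<Sum>k\<in>F \<union> G. (if k \<in> G then e k else 0) * phi k x)" for x
    unfolding G(3) using F(1) G(1) by (intro sum.mono_neutral_cong_left) auto
  have "(\<lambda>x. v x + w x) = (\<lambda>x. \<Sum>k\<in>F \<union> G. ((if k \<in> F then c k else 0) + (if k \<in> G then e k else 0)) * phi k x)"
    unfolding 1 2 by (simp only: distrib_right sum.distrib)
  then show ?thesis
    by (rule ssubst) (rule V_spanI, use F(1,2) G(1,2) in auto)
qed

lemma V_span_scale:
  assumes "v \<in> V_span \<Lambda>" shows "(\<lambda>x. a * v x) \<in> V_span \<Lambda>"
proof -
  obtain F c where F: "finite F" "F \<subseteq> \<Lambda>" "v = (\<lambda>x. \<Sum>k\<in>F. c k * phi k x)" using assms by (rule V_spanE)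
  have "(\<lambda>x. a * v x) = (\<lambda>x. \<Sum>k\<in>F. (a * c k) * phi k x)"
    unfolding F(3) sum_distrib_left mult.assoc ..
  then show ?thesis
    by (rule ssubst) (rule V_spanI[OF F(1,2)])
qed

lemma V_span_diff: "v \<in> V_span \<Lambda> \<Longrightarrow> w \<in> V_span \<Lambda> \<Longrightarrow> (\<lambda>x. v x - w x) \<in> V_span \<Lambda>"
  using V_span_add[OF _ V_span_scale[of w \<Lambda> "-1"], of v] by simp

lemma V_span_mono: "\<Lambda> \<subseteq> \<Lambda>' \<Longrightarrow> V_span \<Lambda> \<subseteq> V_span \<Lambda>'"
  by (auto elim!: V_spanE intro!: V_spanI)

lemma V_span_sum:
  assumes "\<And>i. i \<in> I \<Longrightarrow> v i \<in> V_span \<Lambda>"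
  shows "(\<lambda>x. \<Sum>i\<in>I. v i x) \<in> V_span \<Lambda>"
  using assms
proof (induction I rule: infinite_finite_induct)
  case (insert i I)
  then show ?case using V_span_add[of "v i" \<Lambda>] by simp
qed (auto simp: V_span_zero)

lemma V_span_mult:
  assumes "v \<in> V_span UNIV" "w \<in> V_span UNIV"
  shows "(\<lambda>x. v x * w x) \<in> V_span UNIV"
proof -
  obtain F c where F: "v = (\<lambda>x. \<Sum>k\<in>F. c k * phi k x)" using assms(1) by (rule V_spanE)
  obtain G e where G: "w = (\<lambda>x. \<Sum>k\<in>G. e k * phi k x)" using assms(2) by (rule V_spanE)
  have "v x * w x = (\<Sum>k\<in>F. \<Sum>l\<in>G. (c k * e l * of_real (phi_const TYPE('a))) * phi (k + l) x)" for x
    unfolding F G sum_product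
    by (intro sum.cong refl) (simp add: mult_ac phi_mult[symmetric])
  then show ?thesis by (simp only:) (intro V_span_sum V_span_scaled_phi UNIV_I)
qed

lemma V_span_const: "(\<lambda>x::real^'d. c) \<in> V_span UNIV"
proof -
  have "(\<lambda>x::real^'d. c) = (\<lambda>x. c / of_real (phi_const TYPE('d)) * phi 0 x)"
    using phi_const_pos[where 'd='d] by (simp add: phi_eq)
  then show ?thesis by (rule ssubst) (rule V_span_scaled_phi, simp)
qed

lemma V_span_continuous: "v \<in> V_span \<Lambda> \<Longrightarrow> continuous_on UNIV v"
  unfolding V_span_def by (auto intro!: continuous_on_sum continuous_on_mult continuous_phi)

lemma continuous_imp_L2_Omega:
  fixes v :: "real^'d \<Rightarrow> complex"
  assumes "continuous_on UNIV v"
  shows "v \<in> L2 (lebesgue_on Omega)"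
proof -
  have "continuous_on UNIV (\<lambda>x. complex_of_real ((cmod (v x))\<^sup>2))"
    by (intro continuous_on_of_real continuous_intros assms)
  then have "integrable (lebesgue_on Omega) (\<lambda>x. complex_of_real ((cmod (v x))\<^sup>2))"
    by (rule integrable_lebesgue_on_Omega)
  then have "integrable (lebesgue_on Omega) (\<lambda>x. ((cmod (v x))\<^sup>2))"
    using complex_of_real_integrable_eq by blast
  with integrable_lebesgue_on_Omega[OF assms] show ?thesis
    by (auto simp: L2_def)
qed

lemmas V_span_L2 = continuous_imp_L2_Omega[OF V_span_continuous]

lemma V_span_cos:
  "(\<lambda>x::real^'d. of_real (cos (x $ j - c))) \<in> V_span UNIV"
proof -
  have ph: "cis (x $ j) = phi (axis j 1) x / of_real (phi_const TYPE('d))" for x :: "real^'d"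
    using phi_const_pos[where 'd='d]
    by (simp add: phi_eq phase_def axis_component if_distrib[of of_int] if_distrib[of "\<lambda>t. t * _"] cong: if_cong)
  have ph': "cis (- (x $ j)) = phi (- axis j 1) x / of_real (phi_const TYPE('d))" for x :: "real^'d"
    using ph[of x] by (simp add: cnj_phi[symmetric] flip: cis_cnj)
  have "of_real (cos (x $ j - c)) = (cis (- c) / (2 * of_real (phi_const TYPE('d)))) * phi (axis j 1) x
          + (cis c / (2 * of_real (phi_const TYPE('d)))) * phi (- axis j 1) x" for x :: "real^'d"
  proof -
    have "of_real (cos (x $ j - c)) = (cis (x $ j - c) + cis (- (x $ j - c))) / 2"
      by (simp add: complex_eq_iff del: minus_diff_eq)
    also have "\<dots> = (cis (-c) * cis (x $ j) + cis c * cis (- (x $ j))) / 2"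
      by (simp add: cis_mult)
    finally show ?thesis unfolding ph ph' by (simp add: add_divide_distrib mult_ac)
  qed
  then show ?thesis by (simp only:) (intro V_span_add V_span_scaled_phi UNIV_I)
qed

text \<open>
  Trigonometric polynomials form an algebra, so a real-valued one may be substituted into an algebraic
  polynomial. This lets the one-variable Weierstrass theorem act on functions on the torus.
\<close>
lemma V_span_polynomial:
  assumes "real_polynomial_function p" "(\<lambda>x. of_real (q x)) \<in> V_span UNIV"
  shows "(\<lambda>x. of_real (p (q x :: real))) \<in> V_span UNIV"
  using assms(1)
proof induction
  case (linear f)
  then obtain c where "f = (\<lambda>x. x * c)" by (auto elim: real_bounded_linear[THEN iffD1, THEN exE])
  then show ?case using V_span_scale[OF assms(2), of "of_real c"] by (simp add: mult.commute)
next
  case (const c)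
  show ?case by (rule V_span_const)
next
  case (add f g)
  then show ?case using V_span_add by fastforce
next
  case (mult f g)
  then show ?case using V_span_mult by fastforce
qed

lemma V_span_prod:
  assumes "finite I" "\<And>i. i \<in> I \<Longrightarrow> v i \<in> V_span UNIV"
  shows "(\<lambda>x. \<Prod>i\<in>I. v i x) \<in> V_span UNIV"
  using assms
proof (induction I rule: finite_induct)
  case empty
  show ?case by (simp add: V_span_const)
next
  case (insert i I)
  then show ?case using V_span_mult[of "v i"] by simp
qed

section \<open>Density of trigonometric polynomials in \<open>L\<^sup>2\<close>\<close>

text \<open>
  Membership in the closure of the trigonometric polynomials in \<open>L\<^sup>2\<close> of the cube.
\<close>
definition trig_approximable :: "(real^'d \<Rightarrow> complex) \<Rightarrow> bool" where
  "trig_approximable f \<longleftrightarrow> f \<in> L2 (lebesgue_on Omega) \<and>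
     (\<forall>\<epsilon>>0. \<exists>p\<in>V_span UNIV. sqint (lebesgue_on Omega) (\<lambda>x. f x - p x) < \<epsilon>)"

lemma trig_approximable_V_span: "p \<in> V_span UNIV \<Longrightarrow> trig_approximable p"
  unfolding trig_approximable_def by (auto simp: V_span_L2 sqint_def intro!: bexI[of _ p])

lemma trig_approximable_closed:
  assumes f: "f \<in> L2 (lebesgue_on Omega)"
    and "\<And>\<epsilon>. \<epsilon> > 0 \<Longrightarrow> \<exists>g. trig_approximable g \<and> sqint (lebesgue_on Omega) (\<lambda>x. f x - g x) < \<epsilon>"
  shows "trig_approximable f"
  unfolding trig_approximable_def
proof (intro conjI allI impI f)
  fix \<epsilon> :: real assume e: "\<epsilon> > 0"
  then obtain g where g: "trig_approximable g" "sqint (lebesgue_on Omega) (\<lambda>x. f x - g x) < \<epsilon> / 4"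
    using assms(2)[of "\<epsilon>/4"] by auto
  then obtain p where p: "p \<in> V_span UNIV" "sqint (lebesgue_on Omega) (\<lambda>x. g x - p x) < \<epsilon> / 4"
    using e unfolding trig_approximable_def by (meson divide_pos_pos zero_less_numeral)
  have "sqint (lebesgue_on Omega) (\<lambda>x. (f x - g x) + (g x - p x)) < \<epsilon>"
    using sqint_add_le[OF L2_diff[OF f, of g] L2_diff[of g "lebesgue_on Omega" p]] g p
    by (auto simp: trig_approximable_def V_span_L2)
  with p(1) show "\<exists>p\<in>V_span UNIV. sqint (lebesgue_on Omega) (\<lambda>x. f x - p x) < \<epsilon>" by auto
qed

lemma trig_approximable_add:
  assumes "trig_approximable f" "trig_approximable g"
  shows "trig_approximable (\<lambda>x. f x + g x)"
  unfolding trig_approximable_def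
proof (intro conjI allI impI)
  show "(\<lambda>x. f x + g x) \<in> L2 (lebesgue_on Omega)" using assms by (simp add: trig_approximable_def L2_add)
  fix \<epsilon> :: real assume e: "\<epsilon> > 0"
  then obtain p q where p: "p \<in> V_span UNIV" "sqint (lebesgue_on Omega) (\<lambda>x. f x - p x) < \<epsilon> / 4"
    and q: "q \<in> V_span UNIV" "sqint (lebesgue_on Omega) (\<lambda>x. g x - q x) < \<epsilon> / 4"
    using assms unfolding trig_approximable_def by (meson divide_pos_pos zero_less_numeral)
  have "sqint (lebesgue_on Omega) (\<lambda>x. (f x - p x) + (g x - q x)) < \<epsilon>"
    using sqint_add_le[of "\<lambda>x. f x - p x" "lebesgue_on Omega" "\<lambda>x. g x - q x"] p q assms
    by (auto simp: trig_approximable_def V_span_L2 L2_diff)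
  then show "\<exists>p\<in>V_span UNIV. sqint (lebesgue_on Omega) (\<lambda>x. f x + g x - p x) < \<epsilon>"
    using V_span_add[OF p(1) q(1)] by (intro bexI[of _ "\<lambda>x. p x + q x"]) (auto simp: algebra_simps)
qed

lemma trig_approximable_scale:
  assumes "trig_approximable f"
  shows "trig_approximable (\<lambda>x. c * f x)"
  unfolding trig_approximable_def
proof (intro conjI allI impI)
  show "(\<lambda>x. c * f x) \<in> L2 (lebesgue_on Omega)" using assms by (simp add: trig_approximable_def L2_scale)
  fix \<epsilon> :: real assume e: "\<epsilon> > 0"
  have pos: "(cmod c)\<^sup>2 + 1 > 0" by (smt (verit) zero_le_power2)
  then obtain p where p: "p \<in> V_span UNIV" "sqint (lebesgue_on Omega) (\<lambda>x. f x - p x) < \<epsilon> / ((cmod c)\<^sup>2 + 1)"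
    using assms e unfolding trig_approximable_def by (meson divide_pos_pos)
  have "sqint (lebesgue_on Omega) (\<lambda>x. c * f x - c * p x) = (cmod c)\<^sup>2 * sqint (lebesgue_on Omega) (\<lambda>x. f x - p x)"
    by (simp flip: sqint_scale add: right_diff_distrib)
  also have "\<dots> \<le> ((cmod c)\<^sup>2 + 1) * sqint (lebesgue_on Omega) (\<lambda>x. f x - p x)"
    by (intro mult_right_mono) (auto simp: sqint_nonneg)
  also have "\<dots> < \<epsilon>" using p(2) pos by (simp add: pos_less_divide_eq mult.commute)
  finally show "\<exists>p\<in>V_span UNIV. sqint (lebesgue_on Omega) (\<lambda>x. c * f x - p x) < \<epsilon>"
    using V_span_scale[OF p(1)] by (intro bexI[of _ "\<lambda>x. c * p x"]) auto
qed

lemma trig_approximable_sum: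
  assumes "\<And>i. i \<in> I \<Longrightarrow> trig_approximable (f i)"
  shows "trig_approximable (\<lambda>x. \<Sum>i\<in>I. f i x)"
  using assms
proof (induction I rule: infinite_finite_induct)
  case (insert i I)
  then show ?case using trig_approximable_add[of "f i"] by simp
qed (auto intro!: trig_approximable_V_span V_span_zero)

lemma trig_approximable_dominated:
  assumes s: "\<And>n. trig_approximable (s n)" and f: "f \<in> L2 (lebesgue_on Omega)" and g: "g \<in> L2 (lebesgue_on Omega)"
    and lim: "\<And>x. x \<in> Omega \<Longrightarrow> (\<lambda>n. s n x) \<longlonglongrightarrow> f x"
    and bd: "\<And>n x. x \<in> Omega \<Longrightarrow> cmod (s n x - f x) \<le> cmod (g x)"
  shows "trig_approximable f"
proof (rule trig_approximable_closed[OF f])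
  fix \<epsilon> :: real assume e: "\<epsilon> > 0"
  have "(\<lambda>n. sqint (lebesgue_on Omega) (\<lambda>x. f x - s n x)) \<longlonglongrightarrow> 0"
    using s f g lim bd
    by (intro sqint_dominated_convergence[where g=g]) (auto simp: L2_measurable trig_approximable_def)
  then have "\<forall>\<^sub>F n in sequentially. sqint (lebesgue_on Omega) (\<lambda>x. f x - s n x) < \<epsilon>"
    using e by (rule order_tendstoD)
  then obtain n where "sqint (lebesgue_on Omega) (\<lambda>x. f x - s n x) < \<epsilon>"
    by (auto simp: eventually_sequentially)
  with s show "\<exists>g. trig_approximable g \<and> sqint (lebesgue_on Omega) (\<lambda>x. f x - g x) < \<epsilon>" by blast
qed

lemma trig_approximable_cong_AE:
  assumes "trig_approximable f" "AE x in lebesgue_on Omega. f x = g x" "g \<in> borel_measurable (lebesgue_on Omega)"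
  shows "trig_approximable g"
proof (rule trig_approximable_closed)
  show "g \<in> L2 (lebesgue_on Omega)"
    using L2_cong_AE(1)[OF _ assms(2,3)] assms(1) by (simp add: trig_approximable_def)
  have "sqint (lebesgue_on Omega) (\<lambda>x. g x - f x) = 0"
    using L2_cong_AE(2)[OF _ assms(2,3)] assms(1) by (simp add: trig_approximable_def sqint_def norm_minus_commute)
  then show "\<exists>f. trig_approximable f \<and> sqint (lebesgue_on Omega) (\<lambda>x. g x - f x) < \<epsilon>" if "\<epsilon> > 0" for \<epsilon>
    using assms(1) that by auto
qed

text \<open>
  The ramps \<open>max 0 (min 1 (n y))\<close> converge to the Heaviside function, with value \<open>0\<close> at \<open>0\<close>, and
  Weierstrass approximation of the \<open>n\<close>-th ramp up to \<open>1/(n+1)\<close> preserves both the limit and a uniform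
  bound. The interval \<open>[-2,2]\<close> contains all differences of two cosines.
\<close>
lemma polynomial_heaviside:
  obtains P :: "nat \<Rightarrow> real \<Rightarrow> real" where
    "\<And>n. real_polynomial_function (P n)"
    "\<And>n y. \<bar>y\<bar> \<le> 2 \<Longrightarrow> \<bar>P n y\<bar> \<le> 2"
    "\<And>y. \<bar>y\<bar> \<le> 2 \<Longrightarrow> (\<lambda>n. P n y) \<longlonglongrightarrow> (if 0 < y then 1 else 0)"
proof -
  define ramp where "ramp = (\<lambda>(n::nat) y::real. max 0 (min 1 (real n * y)))"
  have "\<exists>g. real_polynomial_function g \<and> (\<forall>y\<in>{-2..2}. \<bar>ramp n y - g y\<bar> < 1 / (real n + 1))" for n
  proof -
    have "continuous_on {-2..2} (ramp n)" unfolding ramp_def by (intro continuous_intros)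
    from Stone_Weierstrass_real_polynomial_function[OF _ this, of "1 / (real n + 1)"]
    show ?thesis by (metis compact_Icc divide_pos_pos of_nat_0_le_iff zero_less_one add_nonneg_pos)
  qed
  then obtain P where P: "\<And>n. real_polynomial_function (P n)"
    "\<And>n y. y \<in> {-2..2} \<Longrightarrow> \<bar>ramp n y - P n y\<bar> < 1 / (real n + 1)"
    by metis
  have ramp01: "0 \<le> ramp n y" "ramp n y \<le> 1" for n y by (auto simp: ramp_def)
  show ?thesis
  proof
    show "real_polynomial_function (P n)" for n by (rule P)
    show "\<bar>P n y\<bar> \<le> 2" if "\<bar>y\<bar> \<le> 2" for n y
    proof -
      have "1 / (real n + 1) \<le> 1" by simp
      moreover have "\<bar>ramp n y - P n y\<bar> < 1 / (real n + 1)"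
        using that by (intro P(2)) (simp add: abs_le_iff)
      ultimately show ?thesis using ramp01[of n y] by linarith
    qed
    fix y :: real assume y: "\<bar>y\<bar> \<le> 2"
    have ramp: "(\<lambda>n. ramp n y) \<longlonglongrightarrow> (if 0 < y then 1 else 0)"
    proof (rule tendsto_eventually)
      show "\<forall>\<^sub>F n in sequentially. ramp n y = (if 0 < y then 1 else 0)"
      proof (cases "0 < y")
        case True
        obtain N :: nat where N: "1 / y < real N" using reals_Archimedean2 by blast
        have "ramp n y = 1" if "n \<ge> N" for n
        proof -
          have "1 / y \<le> real n" using N that by linarith
          then have "1 \<le> real n * y" using True by (simp add: pos_divide_le_eq)
          then show ?thesis by (simp add: ramp_def)
        qed
        with True show ?thesis by (auto simp: eventually_sequentially)
      next
        case False
        then have "real n * y \<le> 0" for n by (simp add: mult_le_0_iff)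
        then have "ramp n y = 0" for n
          unfolding ramp_def by (intro max.absorb1 min.coboundedI2) auto
        with False show ?thesis by simp
      qed
    qed
    have "(\<lambda>n. ramp n y - P n y) \<longlonglongrightarrow> 0"
    proof (rule tendsto_rabs_zero_cancel, rule tendsto_sandwich[of "\<lambda>_. 0" _ _ "\<lambda>n. 1 / (real n + 1)"])
      show "(\<lambda>n. 1 / (real n + 1)) \<longlonglongrightarrow> 0"
        using LIMSEQ_inverse_real_of_nat by (simp add: inverse_eq_divide add.commute)
      show "\<forall>\<^sub>F n in sequentially. \<bar>ramp n y - P n y\<bar> \<le> 1 / (real n + 1)"
        using y by (intro always_eventually allI less_imp_le P(2)) (simp add: abs_le_iff)
    qed auto
    from tendsto_diff[OF ramp this] show "(\<lambda>n. P n y) \<longlonglongrightarrow> (if 0 < y then 1 else 0)" by simp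
  qed
qed

text \<open>
  Inside a period, an interval is the positivity set of a trigonometric polynomial: the cosine centred
  at its midpoint exceeds its value at the end points exactly there.
\<close>
lemma cos_gt_cos_iff_interval:
  fixes a b t :: real
  assumes "0 \<le> a" "a < b" "b \<le> 2 * pi" "0 < t" "t < 2 * pi"
  shows "cos ((b - a) / 2) < cos (t - (a + b) / 2) \<longleftrightarrow> a < t \<and> t < b"
proof -
  define h y where "h = (b - a) / 2" and "y = \<bar>t - (a + b) / 2\<bar>"
  have h: "0 < h" "h \<le> pi" and y: "0 \<le> y" "y < 2 * pi - h"
    using assms by (auto simp: h_def y_def abs_if field_simps)
  have "cos (t - (a + b) / 2) = cos y" by (simp add: y_def)
  moreover have "cos h < cos y \<longleftrightarrow> y < h"
  proof (cases "y \<le> pi")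
    case True
    then show ?thesis
      using cos_monotone_0_pi[of y h] cos_monotone_0_pi_le[of h y] h y by fastforce
  next
    case False
    have "cos (2 * pi - y) \<le> cos h" using False h y by (intro cos_monotone_0_pi_le) auto
    then show ?thesis using False h by simp
  qed
  moreover have "y < h \<longleftrightarrow> a < t \<and> t < b" by (auto simp: y_def h_def abs_if field_simps)
  ultimately show ?thesis by (simp add: h_def)
qed

abbreviation cindicator :: "'a set \<Rightarrow> 'a \<Rightarrow> complex" where
  "cindicator A x \<equiv> (if x \<in> A then 1 else 0)"

lemma borel_measurable_Omega:
  "f \<in> borel_measurable borel \<Longrightarrow> (f :: real^'d \<Rightarrow> complex) \<in> borel_measurable (lebesgue_on Omega)"
  by (intro measurable_restrict_space1 measurable_completion) simp

text \<open>
  A box is described by the positivity of one trigonometric polynomial \<open>q j\<close> per coordinate, so its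
  indicator is the bounded pointwise limit of the products of \<open>P n (q j)\<close>, with \<open>P n\<close> the polynomials
  approximating the Heaviside function.
\<close>
lemma trig_approximable_box: "trig_approximable (cindicator (box a b))"
proof -
  have [measurable]: "box a b \<in> sets borel" by simp
  have meas: "cindicator (box a b) \<in> borel_measurable (lebesgue_on Omega)"
    by (intro borel_measurable_Omega) measurable
  define a' b' where "a' j = max 0 (a $ j)" and "b' j = min (2 * pi) (b $ j)" for j
  have box: "x \<in> box a b \<longleftrightarrow> (\<forall>j. a' j < x $ j \<and> x $ j < b' j)" if "x \<in> Omega" for x
    using that by (auto simp: Omega_def mem_box_cart a'_def b'_def)
  show ?thesis
  proof (cases "\<forall>j. a' j < b' j")
    case False
    then obtain j where j: "\<not> a' j < b' j" by auto
    have "x \<notin> box a b" if "x \<in> Omega" for x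
    proof
      assume "x \<in> box a b"
      with box[OF that] have "a' j < x $ j" "x $ j < b' j" by auto
      with j show False by simp
    qed
    then have "AE x in lebesgue_on Omega. 0 = cindicator (box a b) x" by (intro AE_I2) auto
    from trig_approximable_cong_AE[OF trig_approximable_V_span[OF V_span_zero] this meas]
    show ?thesis .
  next
    case True
    define q where "q j x = cos (x $ j - (a' j + b' j) / 2) - cos ((b' j - a' j) / 2)" for j x
    have q_pos: "x \<in> box a b \<longleftrightarrow> (\<forall>j. 0 < q j x)" if x: "x \<in> Omega" for x
    proof -
      have "0 < q j x \<longleftrightarrow> a' j < x $ j \<and> x $ j < b' j" for j
        using cos_gt_cos_iff_interval[of "a' j" "b' j" "x $ j"] True x
        by (auto simp: q_def Omega_def mem_box_cart a'_def b'_def)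
      then show ?thesis using box[OF x] by simp
    qed
    have q2: "\<bar>q j x\<bar> \<le> 2" for j x
      unfolding q_def using abs_cos_le_one[of "x $ j - (a' j + b' j) / 2"] abs_cos_le_one[of "(b' j - a' j) / 2"]
      by linarith
    have qV: "(\<lambda>x. of_real (q j x)) \<in> V_span UNIV" for j
      unfolding q_def of_real_diff by (intro V_span_diff V_span_cos V_span_const)
    obtain P :: "nat \<Rightarrow> real \<Rightarrow> real" where P: "\<And>n. real_polynomial_function (P n)"
      "\<And>n y. \<bar>y\<bar> \<le> 2 \<Longrightarrow> \<bar>P n y\<bar> \<le> 2"
      "\<And>y. \<bar>y\<bar> \<le> 2 \<Longrightarrow> (\<lambda>n. P n y) \<longlonglongrightarrow> (if 0 < y then 1 else 0)"
      using polynomial_heaviside by metis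
    define s where "s n x = (\<Prod>j\<in>UNIV. complex_of_real (P n (q j x)))" for n x
    have s_bd: "cmod (s n x) \<le> 2 ^ CARD('a)" for n x
    proof -
      have "cmod (s n x) = (\<Prod>j\<in>UNIV. \<bar>P n (q j x)\<bar>)" by (simp add: s_def prod_norm[symmetric])
      also have "\<dots> \<le> (\<Prod>j\<in>(UNIV::'a set). 2)" by (intro prod_mono) (auto intro: P q2)
      finally show ?thesis by simp
    qed
    show ?thesis
    proof (rule trig_approximable_dominated)
      show "trig_approximable (s n)" for n
        unfolding s_def
        by (rule trig_approximable_V_span[OF V_span_prod[OF finite V_span_polynomial[OF P(1) qV]]])
      show "cindicator (box a b) \<in> L2 (lebesgue_on Omega)"
        by (rule L2_bounded[where B=1, OF finite_measure_Omega meas]) auto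
      show "(\<lambda>_. 2 ^ CARD('a) + 1) \<in> L2 (lebesgue_on (Omega :: (real^'a) set))"
        by (rule continuous_imp_L2_Omega) simp
      show "(\<lambda>n. s n x) \<longlonglongrightarrow> cindicator (box a b) x" if x: "x \<in> Omega" for x
      proof -
        have "(\<lambda>n. s n x) \<longlonglongrightarrow> (\<Prod>j\<in>UNIV. complex_of_real (if 0 < q j x then 1 else 0))"
          unfolding s_def by (intro tendsto_prod tendsto_of_real P q2)
        also have "(\<Prod>j\<in>UNIV. complex_of_real (if 0 < q j x then 1 else 0)) = cindicator (box a b) x"
          unfolding q_pos[OF x] by auto
        finally show ?thesis .
      qed
      show "cmod (s n x - cindicator (box a b) x) \<le> cmod (2 ^ CARD('a) + 1)" for n x
      proof -
        have "cmod (s n x - cindicator (box a b) x) \<le> cmod (s n x) + cmod (cindicator (box a b) x)"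
          by (rule norm_triangle_ineq4)
        also have "\<dots> \<le> 2 ^ CARD('a) + 1" using s_bd[of n x] by (intro add_mono) auto
        also have "\<dots> = cmod (of_real (2 ^ CARD('a) + 1))" by (simp only: norm_of_real) simp
        finally show ?thesis by simp
      qed
    qed
  qed
qed

text \<open>
  Boxes are stable under intersection and generate the Borel sets, and the sets whose indicators are
  approximable form a Dynkin system.
\<close>
lemma trig_approximable_borel:
  fixes A :: "(real^'d) set"
  assumes "A \<in> sets borel"
  shows "trig_approximable (cindicator A)"
proof -
  have gen: "sets (borel :: (real^'d) measure) = sigma_sets UNIV (range (\<lambda>(a, b). box a b))"
    by (subst borel_eq_box) simp
  have Int: "Int_stable (range (\<lambda>(a, b). box a b :: (real^'d) set))"
    by (auto simp: Int_stable_def box_Int_box image_iff)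
  have Pow: "range (\<lambda>(a, b). box a b :: (real^'d) set) \<subseteq> Pow UNIV" by simp
  from assms[unfolded gen] show ?thesis
  proof (induction A rule: sigma_sets_induct_disjoint[OF Int Pow, consumes 1, case_names basic empty compl union])
    case (basic A)
    then show ?case using trig_approximable_box by auto
  next
    case empty
    then show ?case using trig_approximable_V_span[OF V_span_zero] by simp
  next
    case (compl A)
    have "cindicator (UNIV - A) = (\<lambda>x. 1 + (-1) * cindicator A x)" by auto
    then show ?case
      using trig_approximable_add[OF trig_approximable_V_span[OF V_span_const[of 1]] trig_approximable_scale[OF compl(2), of "-1"]]
      by simp
  next
    case (union A)
    have meas: "cindicator (\<Union>i. A i) \<in> borel_measurable (lebesgue_on Omega)"
    proof (rule borel_measurable_Omega)
      have [measurable]: "(\<Union>i. A i) \<in> sets borel" using union(2) unfolding gen[symmetric] by auto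
      show "cindicator (\<Union>i. A i) \<in> borel_measurable borel" by measurable
    qed
    show ?case
    proof (rule trig_approximable_dominated)
      show "trig_approximable (\<lambda>x. \<Sum>i<n. cindicator (A i) x)" for n
        by (intro trig_approximable_sum union)
      show "cindicator (\<Union>i. A i) \<in> L2 (lebesgue_on Omega)"
        by (rule L2_bounded[where B=1, OF finite_measure_Omega meas]) auto
      show "(\<lambda>_. 1) \<in> L2 (lebesgue_on (Omega::(real^'d) set))"
        by (rule continuous_imp_L2_Omega) simp
      have eq: "(\<Sum>i<n. cindicator (A i) x) = cindicator (\<Union>i<n. A i) x" for n x
      proof (cases "\<exists>i<n. x \<in> A i")
        case True
        then obtain i where i: "i < n" "x \<in> A i" by auto
        have "x \<in> A k \<longleftrightarrow> k = i" for k
          using union(1) i by (auto simp: disjoint_family_on_def)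
        then show ?thesis using i by simp
      qed auto
      show "(\<lambda>n. \<Sum>i<n. cindicator (A i) x) \<longlonglongrightarrow> cindicator (\<Union>i. A i) x" for x
        unfolding eq
      proof (rule tendsto_eventually, cases "\<exists>i. x \<in> A i")
        case True
        then obtain i where i: "x \<in> A i" by auto
        show "\<forall>\<^sub>F n in sequentially. cindicator (\<Union>i<n. A i) x = cindicator (\<Union>i. A i) x"
          using eventually_gt_at_top[of i] by eventually_elim (use i in auto)
      qed auto
      show "cmod ((\<Sum>i<n. cindicator (A i) x) - cindicator (\<Union>i. A i) x) \<le> cmod 1" for n x
        unfolding eq by auto
    qed
  qed
qed

lemma trig_approximable_measurable:
  fixes A :: "(real^'d) set"
  assumes "A \<in> sets (lebesgue_on Omega)"
  shows "trig_approximable (cindicator A)"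
proof -
  have "A \<in> sets lebesgue" using assms by (auto simp: sets_restrict_space_iff Omega_eq)
  then obtain S N N' where A: "A = S \<union> N" "N \<subseteq> N'" "N' \<in> null_sets lborel" "S \<in> sets lborel"
    by (rule sets_completionE)
  have "AE x in lebesgue. x \<notin> N'"
    using A(3) by (intro AE_not_in) (auto simp: null_sets_completionI)
  then have "AE x in lebesgue_on Omega. cindicator S x = cindicator A x"
    by (subst AE_restrict_space_iff) (use A(1,2) in \<open>auto simp: Omega_eq elim!: eventually_mono\<close>)
  then show ?thesis
    using A(4) assms by (intro trig_approximable_cong_AE[OF trig_approximable_borel[of S]]) auto
qed

text \<open>
  The simple functions that converge pointwise to \<open>f\<close> can be chosen dominated by \<open>2 |f|\<close>, which makes the
  convergence hold in \<open>L\<^sup>2\<close>.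
\<close>
theorem L2_trig_approximable:
  fixes f :: "real^'d \<Rightarrow> complex"
  assumes f: "f \<in> L2 (lebesgue_on Omega)"
  shows "trig_approximable f"
proof -
  obtain F where F0: "\<forall>i. simple_function (lebesgue_on Omega) (F i)"
    "\<forall>x\<in>space (lebesgue_on Omega). (\<lambda>i. F i x) \<longlonglongrightarrow> f x"
    "\<forall>i. \<forall>x\<in>space (lebesgue_on Omega). dist (F i x) 0 \<le> 2 * dist (f x) 0"
    using borel_measurable_implies_sequence_metric[OF L2_measurable[OF f], of 0] by blast
  then have F: "\<And>i. simple_function (lebesgue_on Omega) (F i)"
    "\<And>x. x \<in> Omega \<Longrightarrow> (\<lambda>i. F i x) \<longlonglongrightarrow> f x"
    "\<And>i x. x \<in> Omega \<Longrightarrow> cmod (F i x) \<le> 2 * cmod (f x)"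
    by simp_all
  show ?thesis
  proof (rule trig_approximable_dominated)
    show "trig_approximable (F i)" for i
    proof (rule trig_approximable_cong_AE)
      show "trig_approximable (\<lambda>x. \<Sum>y\<in>F i ` Omega. y * cindicator (F i -` {y} \<inter> Omega) x)"
        using F(1)[of i]
        by (intro trig_approximable_sum trig_approximable_scale trig_approximable_measurable)
           (auto simp: simple_function_def)
      show "F i \<in> borel_measurable (lebesgue_on Omega)"
        using F(1) by (rule borel_measurable_simple_function)
      have "finite (F i ` Omega)" using F(1)[of i] by (simp add: simple_function_def)
      then show "AE x in lebesgue_on Omega. (\<Sum>y\<in>F i ` Omega. y * cindicator (F i -` {y} \<inter> Omega) x) = F i x"
        by (intro AE_I2) (auto simp: if_distrib[of "\<lambda>t. _ * t"] cong: if_cong)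
    qed
    show "(\<lambda>x. 3 * f x) \<in> L2 (lebesgue_on Omega)" using f by (rule L2_scale)
    show "cmod (F i x - f x) \<le> cmod (3 * f x)" if "x \<in> Omega" for i x
      using norm_triangle_ineq4[of "F i x" "f x"] F(3)[OF that, of i] by (simp add: norm_mult)
  qed (use F f in auto)
qed

section \<open>Parseval's identity\<close>

definition ip :: "(real^'d \<Rightarrow> complex) \<Rightarrow> (real^'d \<Rightarrow> complex) \<Rightarrow> complex" where
  "ip f g = (LINT x|lebesgue_on Omega. f x * cnj (g x))"

lemma ip_self: "f \<in> L2 (lebesgue_on Omega) \<Longrightarrow> ip f f = of_real (sqint (lebesgue_on Omega) f)"
  unfolding ip_def sqint_def integral_complex_of_real[symmetric] by (simp only: complex_norm_square)

lemma ip_commute: "ip g f = cnj (ip f g)"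
proof -
  have "cnj (ip f g) = (LINT x|lebesgue_on Omega. cnj (f x * cnj (g x)))"
    unfolding ip_def by (rule Bochner_Integration.integral_cnj[symmetric])
  then show ?thesis by (simp add: ip_def mult.commute del: Bochner_Integration.integral_cnj)
qed

lemma ip_add_left:
  assumes "f \<in> L2 (lebesgue_on Omega)" "g \<in> L2 (lebesgue_on Omega)" "h \<in> L2 (lebesgue_on Omega)"
  shows "ip (\<lambda>x. f x + g x) h = ip f h + ip g h"
  using assms by (simp add: ip_def distrib_right L2_integrable_mult)

lemma ip_scale_left: "ip (\<lambda>x. c * f x) h = c * ip f h"
  by (simp add: ip_def mult.assoc)

lemma fcoeff_eq_ip: "fcoeff v k = ip v (phi k)"
  by (simp add: fcoeff_def ip_def)

lemma phi_L2: "phi k \<in> L2 (lebesgue_on Omega)"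
  by (intro continuous_imp_L2_Omega continuous_phi)

lemma fcoeff_add:
  "f \<in> L2 (lebesgue_on Omega) \<Longrightarrow> g \<in> L2 (lebesgue_on Omega) \<Longrightarrow> fcoeff (\<lambda>x. f x + g x) k = fcoeff f k + fcoeff g k"
  unfolding fcoeff_eq_ip by (intro ip_add_left phi_L2)

lemma fcoeff_scale: "fcoeff (\<lambda>x. c * f x) k = c * fcoeff f k"
  unfolding fcoeff_eq_ip by (rule ip_scale_left)

lemma fcoeff_diff:
  "f \<in> L2 (lebesgue_on Omega) \<Longrightarrow> g \<in> L2 (lebesgue_on Omega) \<Longrightarrow> fcoeff (\<lambda>x. f x - g x) k = fcoeff f k - fcoeff g k"
  using fcoeff_add[of f "\<lambda>x. -1 * g x" k] L2_scale[of g _ "-1"] fcoeff_scale[of "-1" g k] by simp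

lemma fcoeff_phi: "fcoeff (phi l) k = (if l = k then 1 else 0)"
  unfolding fcoeff_def by (rule phi_orthonormal)

lemma sum_phi_L2: "(\<lambda>x. \<Sum>k\<in>F. c k * phi k x) \<in> L2 (lebesgue_on Omega)"
proof (rule continuous_imp_L2_Omega)
  show "continuous_on UNIV (\<lambda>x. \<Sum>k\<in>F. c k * phi k x)"
    by (intro continuous_on_sum continuous_on_mult continuous_phi continuous_on_const)
qed

lemma ip_sum_phi_left:
  assumes "finite F" "h \<in> L2 (lebesgue_on Omega)"
  shows "ip (\<lambda>x. \<Sum>k\<in>F. c k * phi k x) h = (\<Sum>k\<in>F. c k * cnj (fcoeff h k))"
  using assms(1)
proof (induction F rule: finite_induct)
  case (insert k F)
  have "ip (\<lambda>x. c k * phi k x + (\<Sum>k\<in>F. c k * phi k x)) h = c k * ip (phi k) h + ip (\<lambda>x. \<Sum>k\<in>F. c k * phi k x) h"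
    by (subst ip_add_left) (auto intro!: L2_scale phi_L2 sum_phi_L2 assms simp: ip_scale_left)
  also have "ip (phi k) h = cnj (fcoeff h k)"
    unfolding fcoeff_eq_ip by (rule ip_commute)
  finally show ?case using insert by simp
qed (simp add: ip_def)

lemma fcoeff_sum_phi:
  assumes "finite F"
  shows "fcoeff (\<lambda>x. \<Sum>k\<in>F. c k * phi k x) l = (if l \<in> F then c l else 0)"
  unfolding fcoeff_eq_ip[of "\<lambda>x. \<Sum>k\<in>F. c k * phi k x"] ip_sum_phi_left[OF assms phi_L2] fcoeff_phi
  using assms by (simp add: if_distrib[of cnj] if_distrib[of "\<lambda>t. _ * t"] cong: if_cong)

text \<open>
  Completing the square: among all trigonometric polynomials with modes in \<open>F\<close>, the one with the Fourier
  coefficients of \<open>v\<close> is the closest to \<open>v\<close>.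
\<close>
lemma sqint_diff_sum_phi:
  assumes F: "finite F" and v: "v \<in> L2 (lebesgue_on Omega)"
  shows "sqint (lebesgue_on Omega) (\<lambda>x. v x - (\<Sum>k\<in>F. c k * phi k x))
     = sqint (lebesgue_on Omega) v - (\<Sum>k\<in>F. (cmod (fcoeff v k))\<^sup>2) + (\<Sum>k\<in>F. (cmod (fcoeff v k - c k))\<^sup>2)"
proof -
  let ?p = "\<lambda>x. \<Sum>k\<in>F. c k * phi k x"
  have p: "?p \<in> L2 (lebesgue_on Omega)" "(\<lambda>x. -1 * ?p x) \<in> L2 (lebesgue_on Omega)"
    by (intro L2_scale sum_phi_L2)+
  have vp: "(\<lambda>x. v x - ?p x) \<in> L2 (lebesgue_on Omega)" by (intro L2_diff v p)
  have left: "ip (\<lambda>x. v x - ?p x) h = ip v h - ip ?p h" if "h \<in> L2 (lebesgue_on Omega)" for h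
    using ip_add_left[OF v p(2) that] ip_scale_left[of "-1" ?p h] by simp
  have "complex_of_real (sqint (lebesgue_on Omega) (\<lambda>x. v x - ?p x)) = ip (\<lambda>x. v x - ?p x) (\<lambda>x. v x - ?p x)"
    by (rule ip_self[OF vp, symmetric])
  also have "\<dots> = ip v (\<lambda>x. v x - ?p x) - ip ?p (\<lambda>x. v x - ?p x)"
    by (rule left[OF vp])
  also have "ip v (\<lambda>x. v x - ?p x) = cnj (ip v v - ip ?p v)"
    by (subst ip_commute, subst left[OF v]) simp
  also have "ip ?p (\<lambda>x. v x - ?p x) = (\<Sum>k\<in>F. c k * cnj (fcoeff v k - c k))"
    using F by (simp add: ip_sum_phi_left[OF F vp] fcoeff_diff[OF v p(1)] fcoeff_sum_phi[OF F])
  also have "ip ?p v = (\<Sum>k\<in>F. c k * cnj (fcoeff v k))" by (rule ip_sum_phi_left[OF F v])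
  also have "cnj (ip v v - (\<Sum>k\<in>F. c k * cnj (fcoeff v k))) - (\<Sum>k\<in>F. c k * cnj (fcoeff v k - c k))
     = of_real (sqint (lebesgue_on Omega) v) - (\<Sum>k\<in>F. fcoeff v k * cnj (fcoeff v k))
        + (\<Sum>k\<in>F. (fcoeff v k - c k) * cnj (fcoeff v k - c k))"
    unfolding ip_self[OF v]
    by (simp add: algebra_simps sum.distrib sum_subtractf)
  also have "\<dots> = of_real (sqint (lebesgue_on Omega) v - (\<Sum>k\<in>F. (cmod (fcoeff v k))\<^sup>2) + (\<Sum>k\<in>F. (cmod (fcoeff v k - c k))\<^sup>2))"
    by (simp only: of_real_add of_real_diff of_real_sum complex_norm_square)
  finally show ?thesis using of_real_eq_iff by blast
qed

text \<open>
  Bessel's inequality bounds the sum from above. For the other direction, the Fourier truncation to the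
  modes of a good approximating polynomial is at least as good as that polynomial.
\<close>
theorem parseval:
  assumes v: "v \<in> L2 (lebesgue_on Omega)"
  shows "((\<lambda>k. (cmod (fcoeff v k))\<^sup>2) has_sum sqint (lebesgue_on Omega) v) UNIV"
proof -
  have bessel: "(\<Sum>k\<in>F. (cmod (fcoeff v k))\<^sup>2) \<le> sqint (lebesgue_on Omega) v" if "finite F" for F
    using sqint_diff_sum_phi[OF that v, of "fcoeff v"] sqint_nonneg[of "lebesgue_on Omega" "\<lambda>x. v x - (\<Sum>k\<in>F. fcoeff v k * phi k x)"]
    by simp
  have summ: "(\<lambda>k. (cmod (fcoeff v k))\<^sup>2) summable_on UNIV"
    by (rule nonneg_bdd_above_summable_on) (auto intro!: bdd_aboveI2 bessel)
  have "(\<Sum>\<^sub>\<infinity>k. (cmod (fcoeff v k))\<^sup>2) \<le> sqint (lebesgue_on Omega) v"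
    by (rule infsum_le_finite_sums[OF summ bessel]) auto
  moreover have "sqint (lebesgue_on Omega) v \<le> (\<Sum>\<^sub>\<infinity>k. (cmod (fcoeff v k))\<^sup>2)"
  proof (rule field_le_epsilon)
    fix \<epsilon> :: real assume "\<epsilon> > 0"
    then obtain p where p: "p \<in> V_span UNIV" "sqint (lebesgue_on Omega) (\<lambda>x. v x - p x) < \<epsilon>"
      using L2_trig_approximable[OF v] unfolding trig_approximable_def by blast
    from p(1) obtain F c where F: "finite F" "p = (\<lambda>x. \<Sum>k\<in>F. c k * phi k x)" by (rule V_spanE)
    have "sqint (lebesgue_on Omega) v - (\<Sum>k\<in>F. (cmod (fcoeff v k))\<^sup>2) \<le> sqint (lebesgue_on Omega) (\<lambda>x. v x - p x)"
      unfolding F(2) sqint_diff_sum_phi[OF F(1) v] by (simp add: sum_nonneg)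
    moreover have "(\<Sum>k\<in>F. (cmod (fcoeff v k))\<^sup>2) \<le> (\<Sum>\<^sub>\<infinity>k. (cmod (fcoeff v k))\<^sup>2)"
      by (rule finite_sum_le_infsum[OF summ F(1)]) auto
    ultimately show "sqint (lebesgue_on Omega) v \<le> (\<Sum>\<^sub>\<infinity>k. (cmod (fcoeff v k))\<^sup>2) + \<epsilon>"
      using p(2) by linarith
  qed
  ultimately show ?thesis using has_sum_infsum[OF summ] by (metis order_antisym)
qed

lemma sqint_eq_0_imp_AE:
  assumes "f \<in> L2 M" "sqint M f = 0"
  shows "AE x in M. f x = 0"
proof -
  have "AE x in M. (cmod (f x))\<^sup>2 = 0"
    using assms integral_nonneg_eq_0_iff_AE[of M "\<lambda>x. (cmod (f x))\<^sup>2"] by (auto simp: L2_def sqint_def)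
  then show ?thesis by simp
qed

corollary fcoeff_unique:
  assumes "f \<in> L2 (lebesgue_on Omega)" "g \<in> L2 (lebesgue_on Omega)" "\<And>k. fcoeff f k = fcoeff g k"
  shows "AE x in lebesgue_on Omega. f x = g x"
proof -
  have "((\<lambda>k. (cmod (fcoeff (\<lambda>x. f x - g x) k))\<^sup>2) has_sum sqint (lebesgue_on Omega) (\<lambda>x. f x - g x)) UNIV"
    using assms by (intro parseval L2_diff)
  moreover have "((\<lambda>k. (cmod (fcoeff (\<lambda>x. f x - g x) k))\<^sup>2) has_sum 0) UNIV"
    using assms by (simp add: fcoeff_diff)
  ultimately have "sqint (lebesgue_on Omega) (\<lambda>x. f x - g x) = 0" by (rule has_sum_unique)
  from sqint_eq_0_imp_AE[OF L2_diff[OF assms(1,2)] this] show ?thesis by simp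
qed

section \<open>Periodic Sobolev functions and their Fourier coefficients\<close>

lemma L2p_iff: "v \<in> L2p \<longleftrightarrow> periodic v \<and> v \<in> L2 (lebesgue_on Omega)"
  by (auto simp: L2p_def L2_def)

lemma L2p_imp_L2: "v \<in> L2p \<Longrightarrow> v \<in> L2 (lebesgue_on Omega)"
  by (simp add: L2p_iff)

lemma L2p_add: "v \<in> L2p \<Longrightarrow> w \<in> L2p \<Longrightarrow> (\<lambda>x. v x + w x) \<in> L2p"
  by (simp add: L2p_iff L2_add periodic_def)

lemma L2p_scale: "v \<in> L2p \<Longrightarrow> (\<lambda>x. c * v x) \<in> L2p"
  by (simp add: L2p_iff L2_scale periodic_def)

lemma phi_L2p: "phi k \<in> L2p"
  by (simp add: L2p_iff phi_L2 periodic_phi)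

lemma L2_integrable_mult_continuous:
  assumes "f \<in> L2 (lebesgue_on Omega)" "continuous_on UNIV \<psi>"
  shows "integrable (lebesgue_on Omega) (\<lambda>x. f x * \<psi> x)"
proof -
  have "(\<lambda>x. cnj (\<psi> x)) \<in> L2 (lebesgue_on Omega)"
    by (intro continuous_imp_L2_Omega continuous_on_cnj assms)
  from L2_integrable_mult[OF assms(1) this] show ?thesis by simp
qed

lemma Ck_continuous:
  assumes "\<And>m. Ck m \<psi>"
  shows "continuous_on UNIV \<psi>" "continuous_on UNIV (pderiv_at j \<psi>)"
  using assms[of 0] assms[of 1] by auto

lemma has_weak_pderiv_add:
  assumes "v \<in> L2 (lebesgue_on Omega)" "w \<in> L2 (lebesgue_on Omega)" "g \<in> L2 (lebesgue_on Omega)" "h \<in> L2 (lebesgue_on Omega)"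
    and "has_weak_pderiv j v g" "has_weak_pderiv j w h"
  shows "has_weak_pderiv j (\<lambda>x. v x + w x) (\<lambda>x. g x + h x)"
  unfolding has_weak_pderiv_def
proof (intro allI impI)
  fix \<psi> :: "real^'a \<Rightarrow> complex" assume psi: "periodic \<psi> \<and> (\<forall>m. Ck m \<psi>)"
  then have c: "continuous_on UNIV \<psi>" "continuous_on UNIV (pderiv_at j \<psi>)" using Ck_continuous by blast+
  show "(LINT x|lebesgue_on Omega. (v x + w x) * pderiv_at j \<psi> x) = - (LINT x|lebesgue_on Omega. (g x + h x) * \<psi> x)"
    using assms(5,6) psi
    by (simp add: has_weak_pderiv_def distrib_right L2_integrable_mult_continuous assms c)
qed

lemma has_weak_pderiv_scale:
  assumes "has_weak_pderiv j v g"
  shows "has_weak_pderiv j (\<lambda>x. c * v x) (\<lambda>x. c * g x)"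
  using assms unfolding has_weak_pderiv_def by (simp add: mult.assoc)

lemma has_weak_pderiv_phi: "has_weak_pderiv j (phi k) (\<lambda>x. \<i> * of_int (k $ j) * phi k x)"
  unfolding has_weak_pderiv_def using integral_phi_pderiv by blast

text \<open>
  Testing the weak derivative with the smooth function \<open>cnj (phi k)\<close> determines its \<open>k\<close>-th coefficient.
\<close>
lemma fcoeff_weak_pderiv:
  assumes "has_weak_pderiv j v g"
  shows "fcoeff g k = \<i> * of_int (k $ j) * fcoeff v k"
proof -
  have "periodic (phi (- k))" "\<forall>m. Ck m (phi (- k))"
    using periodic_phi Ck_phi[of _ 1 "-k"] by auto
  with assms have "(LINT x|lebesgue_on Omega. v x * pderiv_at j (phi (-k)) x) = - (LINT x|lebesgue_on Omega. g x * phi (-k) x)"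
    unfolding has_weak_pderiv_def by blast
  moreover have "(LINT x|lebesgue_on Omega. v x * pderiv_at j (phi (-k)) x)
      = - \<i> * of_int (k $ j) * (LINT x|lebesgue_on Omega. v x * phi (-k) x)"
    by (subst integral_mult_right_zero[symmetric]) (simp add: pderiv_phi mult_ac)
  ultimately show ?thesis by (simp add: fcoeff_def cnj_phi)
qed

lemma H1p_imp_L2: "v \<in> H1p \<Longrightarrow> v \<in> L2 (lebesgue_on Omega)"
  by (simp add: H1p_def L2p_imp_L2)

lemma weak_pderiv_spec:
  assumes "v \<in> H1p"
  shows "weak_pderiv j v \<in> L2p \<and> has_weak_pderiv j v (weak_pderiv j v)"
proof -
  have "\<exists>g. g \<in> L2p \<and> has_weak_pderiv j v g" using assms by (auto simp: H1p_def)
  then show ?thesis unfolding weak_pderiv_def by (rule someI_ex)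
qed

lemma weak_pderiv_L2: "v \<in> H1p \<Longrightarrow> weak_pderiv j v \<in> L2 (lebesgue_on Omega)"
  using weak_pderiv_spec L2p_imp_L2 by blast

lemma fcoeff_weak_pderiv_H1p: "v \<in> H1p \<Longrightarrow> fcoeff (weak_pderiv j v) k = \<i> * of_int (k $ j) * fcoeff v k"
  using weak_pderiv_spec fcoeff_weak_pderiv by blast

text \<open>
  By completeness the Fourier coefficients identify the weak derivative up to a null set, which makes
  the choice of a representative harmless and the weak derivative linear almost everywhere.
\<close>
lemma weak_pderiv_unique:
  assumes "v \<in> H1p" "g \<in> L2 (lebesgue_on Omega)" "\<And>k. fcoeff g k = \<i> * of_int (k $ j) * fcoeff v k"
  shows "AE x in lebesgue_on Omega. weak_pderiv j v x = g x"
  using assms by (intro fcoeff_unique weak_pderiv_L2) (auto simp: fcoeff_weak_pderiv_H1p)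

lemma H1p_add:
  assumes "v \<in> H1p" "w \<in> H1p" shows "(\<lambda>x. v x + w x) \<in> H1p"
proof -
  have "has_weak_pderiv j (\<lambda>x. v x + w x) (\<lambda>x. weak_pderiv j v x + weak_pderiv j w x)" for j
    using assms weak_pderiv_spec by (intro has_weak_pderiv_add) (auto intro: weak_pderiv_L2 H1p_imp_L2)
  moreover have "(\<lambda>x. weak_pderiv j v x + weak_pderiv j w x) \<in> L2p" for j
    using assms weak_pderiv_spec by (intro L2p_add) auto
  ultimately show ?thesis using assms unfolding H1p_def by (blast intro: L2p_add)
qed

lemma H1p_scale:
  assumes "v \<in> H1p" shows "(\<lambda>x. c * v x) \<in> H1p"
proof -
  have "has_weak_pderiv j (\<lambda>x. c * v x) (\<lambda>x. c * weak_pderiv j v x)" for j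
    using assms weak_pderiv_spec by (intro has_weak_pderiv_scale) auto
  moreover have "(\<lambda>x. c * weak_pderiv j v x) \<in> L2p" for j
    using assms weak_pderiv_spec by (intro L2p_scale) auto
  ultimately show ?thesis using assms unfolding H1p_def by (blast intro: L2p_scale)
qed

lemma H1p_diff: "v \<in> H1p \<Longrightarrow> w \<in> H1p \<Longrightarrow> (\<lambda>x. v x - w x) \<in> H1p"
  using H1p_add[OF _ H1p_scale[of w "-1"], of v] by simp

lemma phi_H1p: "phi k \<in> H1p"
  unfolding H1p_def using phi_L2p has_weak_pderiv_phi L2p_scale by blast

lemma zero_H1p: "(\<lambda>x. 0) \<in> H1p"
  using H1p_scale[OF phi_H1p, of 0] by simp

lemma V_span_H1p:
  assumes "v \<in> V_span \<Lambda>" shows "v \<in> H1p"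
proof -
  from assms obtain F c where "finite F" and v: "v = (\<lambda>x. \<Sum>k\<in>F. c k * phi k x)" by (rule V_spanE)
  then show ?thesis unfolding v
  proof (induction F rule: finite_induct)
    case (insert k F)
    then show ?case using H1p_add[OF H1p_scale[OF phi_H1p]] by simp
  qed (simp add: zero_H1p)
qed

lemma weak_pderiv_add_AE:
  assumes "u \<in> H1p" "v \<in> H1p"
  shows "AE x in lebesgue_on Omega. weak_pderiv j (\<lambda>x. u x + v x) x = weak_pderiv j u x + weak_pderiv j v x"
  using assms
  by (intro weak_pderiv_unique H1p_add L2_add weak_pderiv_L2)
     (auto simp: fcoeff_add weak_pderiv_L2 H1p_imp_L2 fcoeff_weak_pderiv_H1p distrib_left algebra_simps)

lemma weak_pderiv_scale_AE:
  assumes "u \<in> H1p"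
  shows "AE x in lebesgue_on Omega. weak_pderiv j (\<lambda>x. c * u x) x = c * weak_pderiv j u x"
  using assms
  by (intro weak_pderiv_unique H1p_scale L2_scale weak_pderiv_L2)
     (auto simp: fcoeff_scale fcoeff_weak_pderiv_H1p)

text \<open>
  The classical expression for the square of the \<open>H\<^sup>1\<close> norm in terms of integrals, to which the spectral
  definition is reduced below.
\<close>
definition H1sq :: "(real^'d \<Rightarrow> complex) \<Rightarrow> real" where
  "H1sq v = sqint (lebesgue_on Omega) v + (\<Sum>j\<in>UNIV. sqint (lebesgue_on Omega) (weak_pderiv j v))"

text \<open>
  The weight \<open>1 + |k|\<^sup>2\<close> splits into \<open>1\<close> and the \<open>k\<^sub>j\<^sup>2\<close>, which are the Parseval sums of \<open>v\<close> and of its weak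
  partial derivatives.
\<close>
lemma has_sum_H1sq:
  assumes v: "v \<in> H1p"
  shows "((\<lambda>k. weight k * (cmod (fcoeff v k))\<^sup>2) has_sum H1sq v) UNIV"
proof -
  have D: "((\<lambda>k. (of_int (k $ j))\<^sup>2 * (cmod (fcoeff v k))\<^sup>2) has_sum sqint (lebesgue_on Omega) (weak_pderiv j v)) UNIV" for j
    using parseval[OF weak_pderiv_L2[OF v, of j]]
    by (simp add: fcoeff_weak_pderiv_H1p[OF v] norm_mult power_mult_distrib)
  have "((\<lambda>k. \<Sum>j\<in>J. (of_int (k $ j))\<^sup>2 * (cmod (fcoeff v k))\<^sup>2) has_sum (\<Sum>j\<in>J. sqint (lebesgue_on Omega) (weak_pderiv j v))) UNIV" if "finite J" for J
    using that
  proof (induction J rule: finite_induct)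
    case (insert j J)
    then show ?case using has_sum_add[OF D[of j]] by simp
  qed simp
  from has_sum_add[OF parseval[OF H1p_imp_L2[OF v]] this[OF finite_class.finite_UNIV]]
  show ?thesis by (simp add: H1sq_def weight_def algebra_simps sum_distrib_left)
qed

lemma H1_norm_eq: "v \<in> H1p \<Longrightarrow> H1_norm v = sqrt (H1sq v)"
  unfolding H1_norm_def using infsumI[OF has_sum_H1sq] by simp

lemma H1sq_nonneg: "H1sq v \<ge> 0"
  by (simp add: H1sq_def sqint_nonneg sum_nonneg)

lemma H1sq_eq_0_imp_AE:
  assumes "v \<in> H1p" "H1sq v = 0"
  shows "AE x in lebesgue_on Omega. v x = 0"
proof -
  have "sqint (lebesgue_on Omega) v = 0"
    using assms(2) sqint_nonneg[of "lebesgue_on Omega" v] sum_nonneg[of UNIV "\<lambda>j. sqint (lebesgue_on Omega) (weak_pderiv j v)"]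
      sqint_nonneg[of "lebesgue_on Omega"]
    unfolding H1sq_def by (smt (verit))
  then show ?thesis by (rule sqint_eq_0_imp_AE[OF H1p_imp_L2[OF assms(1)]])
qed

section \<open>The energy of the elliptic form\<close>

text \<open>
  The weighted \<open>L\<^sup>2\<close> inner product. The elliptic form is a sum of such products
  (\<open>form_a_eq_wip\<close> below), so its algebraic properties are checked once for each summand.
\<close>
definition wip :: "(real^'d \<Rightarrow> real) \<Rightarrow> (real^'d \<Rightarrow> complex) \<Rightarrow> (real^'d \<Rightarrow> complex) \<Rightarrow> complex" where
  "wip c f g = (LINT x|lebesgue_on Omega. of_real (c x) * f x * cnj (g x))"

lemma coefficientD:
  assumes "coefficient c lo hi"
  shows "0 < lo" "lo \<le> hi" "\<And>x. lo \<le> c x" "\<And>x. c x \<le> hi" "continuous_on UNIV c"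
proof -
  show "0 < lo" "\<And>x. lo \<le> c x" "\<And>x. c x \<le> hi" using assms by (auto simp: coefficient_def)
  then show "lo \<le> hi" by (meson order_trans)
  show "continuous_on UNIV c"
    using assms by (auto simp: coefficient_def intro: differentiable_imp_continuous_on)
qed

lemma coefficient_mult_L2:
  assumes c: "coefficient c lo hi" and f: "f \<in> L2 (lebesgue_on Omega)"
  shows "(\<lambda>x. of_real (c x) * f x) \<in> L2 (lebesgue_on Omega)"
proof (rule L2_dominated[OF _ f, of _ hi])
  note [measurable] = L2_measurable[OF f]
  have "continuous_on UNIV (\<lambda>x. complex_of_real (c x))"
    using coefficientD(5)[OF c] by (rule continuous_on_of_real)
  then have [measurable]: "(\<lambda>x. complex_of_real (c x)) \<in> borel_measurable (lebesgue_on Omega)"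
    by (rule L2_measurable[OF continuous_imp_L2_Omega])
  show "(\<lambda>x. of_real (c x) * f x) \<in> borel_measurable (lebesgue_on Omega)" by measurable
  have "\<bar>c x\<bar> \<le> hi" for x using coefficientD(1,3,4)[OF c] by (smt (verit))
  then show "cmod (of_real (c x) * f x) \<le> hi * cmod (f x)" for x
    by (simp add: norm_mult mult_right_mono)
qed

lemma wip_eq_ip: "wip c f g = ip (\<lambda>x. of_real (c x) * f x) g"
  by (simp add: wip_def ip_def)

lemma wip_add_left:
  assumes "coefficient c lo hi" "f \<in> L2 (lebesgue_on Omega)" "g \<in> L2 (lebesgue_on Omega)" "h \<in> L2 (lebesgue_on Omega)"
  shows "wip c (\<lambda>x. f x + g x) h = wip c f h + wip c g h"
  unfolding wip_eq_ip distrib_left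
  by (intro ip_add_left coefficient_mult_L2[OF assms(1)] assms)

lemma wip_scale_left: "wip c (\<lambda>x. a * f x) h = a * wip c f h"
  unfolding wip_eq_ip ip_scale_left[symmetric] by (simp add: mult.left_commute)

lemma wip_commute: "wip c g f = cnj (wip c f g)"
proof -
  have "cnj (wip c f g) = (LINT x|lebesgue_on Omega. cnj (of_real (c x) * f x * cnj (g x)))"
    unfolding wip_def by (rule Bochner_Integration.integral_cnj[symmetric])
  then show ?thesis by (simp add: wip_def mult_ac del: Bochner_Integration.integral_cnj)
qed

lemma wip_cong_AE_left:
  assumes "coefficient c lo hi" "f \<in> L2 (lebesgue_on Omega)" "g \<in> L2 (lebesgue_on Omega)" "h \<in> L2 (lebesgue_on Omega)"
    and "AE x in lebesgue_on Omega. f x = g x"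
  shows "wip c f h = wip c g h"
  unfolding wip_def
  using assms(5) assms(2,3,4)[THEN coefficient_mult_L2[OF assms(1)]] assms(4)
  by (intro integral_cong_AE)
     (auto intro!: borel_measurable_integrable L2_integrable_mult elim: eventually_mono)

lemma wip_self:
  assumes c: "coefficient c lo hi" and f: "f \<in> L2 (lebesgue_on Omega)"
  shows "lo * sqint (lebesgue_on Omega) f \<le> Re (wip c f f)" "Re (wip c f f) \<le> hi * sqint (lebesgue_on Omega) f"
proof -
  have eq: "of_real (c x) * f x * cnj (f x) = of_real (c x * (cmod (f x))\<^sup>2)" for x
    by (simp only: of_real_mult complex_norm_square mult.assoc)
  have "integrable (lebesgue_on Omega) (\<lambda>x. of_real (c x) * f x * cnj (f x))"
    by (intro L2_integrable_mult coefficient_mult_L2[OF c] f)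
  then have int: "integrable (lebesgue_on Omega) (\<lambda>x. c x * (cmod (f x))\<^sup>2)"
    unfolding eq by (simp only: complex_of_real_integrable_eq)
  have Re: "Re (wip c f f) = (LINT x|lebesgue_on Omega. c x * (cmod (f x))\<^sup>2)"
    unfolding wip_def eq by (simp only: integral_complex_of_real Re_complex_of_real)
  have "lo * sqint (lebesgue_on Omega) f = (LINT x|lebesgue_on Omega. lo * (cmod (f x))\<^sup>2)" by (simp add: sqint_def)
  also have "\<dots> \<le> Re (wip c f f)" unfolding Re
    using coefficientD(3)[OF c] L2_integrable_square[OF f]
    by (intro integral_mono int) (auto intro: mult_right_mono)
  finally show "lo * sqint (lebesgue_on Omega) f \<le> Re (wip c f f)" .
  have "Re (wip c f f) \<le> (LINT x|lebesgue_on Omega. hi * (cmod (f x))\<^sup>2)" unfolding Re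
    using coefficientD(4)[OF c] L2_integrable_square[OF f]
    by (intro integral_mono int) (auto intro: mult_right_mono)
  also have "\<dots> = hi * sqint (lebesgue_on Omega) f" by (simp add: sqint_def)
  finally show "Re (wip c f f) \<le> hi * sqint (lebesgue_on Omega) f" .
qed

locale elliptic_form =
  fixes \<nu> \<sigma> :: "real^'d \<Rightarrow> real" and \<nu>lo \<nu>up \<sigma>lo \<sigma>up :: real
  assumes coeff_\<nu>: "coefficient \<nu> \<nu>lo \<nu>up" and coeff_\<sigma>: "coefficient \<sigma> \<sigma>lo \<sigma>up"
begin

abbreviation a :: "(real^'d \<Rightarrow> complex) \<Rightarrow> (real^'d \<Rightarrow> complex) \<Rightarrow> complex" where
  "a \<equiv> form_a \<nu> \<sigma>"

definition \<alpha>lo :: real where "\<alpha>lo = min \<nu>lo \<sigma>lo"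
definition \<alpha>up :: real where "\<alpha>up = max \<nu>up \<sigma>up"

definition energy :: "(real^'d \<Rightarrow> complex) \<Rightarrow> real" where
  "energy v = Re (a v v)"

lemma \<alpha>_bounds: "0 < \<alpha>lo" "\<alpha>lo \<le> \<alpha>up" "0 < \<alpha>up"
  using coefficientD(1,2)[OF coeff_\<nu>] coefficientD(1,2)[OF coeff_\<sigma>]
  by (auto simp: \<alpha>lo_def \<alpha>up_def)

lemma form_a_eq_wip:
  assumes "u \<in> H1p" "v \<in> H1p"
  shows "a u v = (\<Sum>j\<in>UNIV. wip \<nu> (weak_pderiv j u) (weak_pderiv j v)) + wip \<sigma> u v"
proof -
  have "integrable (lebesgue_on Omega) (\<lambda>x. of_real (\<nu> x) * weak_pderiv j u x * cnj (weak_pderiv j v x))" for j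
    by (intro L2_integrable_mult coefficient_mult_L2[OF coeff_\<nu>] weak_pderiv_L2 assms)
  then show ?thesis
    unfolding form_a_def wip_def by (simp add: sum_distrib_left Bochner_Integration.integral_sum mult.assoc)
qed

lemma form_commute:
  assumes "u \<in> H1p" "v \<in> H1p"
  shows "a v u = cnj (a u v)"
proof -
  have "wip c (weak_pderiv j v) (weak_pderiv j u) = cnj (wip c (weak_pderiv j u) (weak_pderiv j v))" for c j
    by (rule wip_commute)
  then show ?thesis
    unfolding form_a_eq_wip[OF assms] form_a_eq_wip[OF assms(2,1)] wip_commute[of \<sigma> v u] by simp
qed

lemma form_add_left:
  assumes "u \<in> H1p" "v \<in> H1p" "w \<in> H1p"
  shows "a (\<lambda>x. u x + v x) w = a u w + a v w"
proof -
  have "wip \<nu> (weak_pderiv j (\<lambda>x. u x + v x)) (weak_pderiv j w)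
      = wip \<nu> (weak_pderiv j u) (weak_pderiv j w) + wip \<nu> (weak_pderiv j v) (weak_pderiv j w)" for j
    using wip_cong_AE_left[OF coeff_\<nu> _ _ _ weak_pderiv_add_AE[OF assms(1,2), of j]]
      wip_add_left[OF coeff_\<nu>]
    by (simp add: weak_pderiv_L2 H1p_add L2_add assms)
  moreover have "wip \<sigma> (\<lambda>x. u x + v x) w = wip \<sigma> u w + wip \<sigma> v w"
    using assms by (intro wip_add_left[OF coeff_\<sigma>] H1p_imp_L2)
  ultimately show ?thesis
    using assms by (simp add: form_a_eq_wip H1p_add sum.distrib)
qed

lemma form_scale_left:
  assumes "u \<in> H1p" "w \<in> H1p"
  shows "a (\<lambda>x. c * u x) w = c * a u w"
proof -
  have "wip \<nu> (weak_pderiv j (\<lambda>x. c * u x)) (weak_pderiv j w) = c * wip \<nu> (weak_pderiv j u) (weak_pderiv j w)" for j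
    using wip_cong_AE_left[OF coeff_\<nu> _ _ _ weak_pderiv_scale_AE[OF assms(1), of j c]]
    by (simp add: weak_pderiv_L2 H1p_scale L2_scale assms wip_scale_left)
  then show ?thesis
    using assms by (simp add: form_a_eq_wip H1p_scale wip_scale_left sum_distrib_left distrib_left)
qed

lemma form_diff_left:
  assumes "u \<in> H1p" "v \<in> H1p" "w \<in> H1p"
  shows "a (\<lambda>x. u x - v x) w = a u w - a v w"
  using form_add_left[OF assms(1) H1p_scale[OF assms(2), of "-1"] assms(3)]
    form_scale_left[OF assms(2,3), of "-1"] by simp

lemma form_add_right:
  assumes "u \<in> H1p" "v \<in> H1p" "w \<in> H1p"
  shows "a w (\<lambda>x. u x + v x) = a w u + a w v"
  using form_commute[OF H1p_add[OF assms(1,2)] assms(3)] form_add_left[OF assms]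
    form_commute[OF assms(1,3)] form_commute[OF assms(2,3)] by simp

lemma form_scale_right:
  assumes "u \<in> H1p" "w \<in> H1p"
  shows "a w (\<lambda>x. c * u x) = cnj c * a w u"
  using form_commute[OF H1p_scale[OF assms(1), of c] assms(2)] form_scale_left[OF assms, of c]
    form_commute[OF assms] by simp

lemma form_diff_right:
  assumes "u \<in> H1p" "v \<in> H1p" "w \<in> H1p"
  shows "a w (\<lambda>x. u x - v x) = a w u - a w v"
  using form_add_right[OF assms(1) H1p_scale[OF assms(2), of "-1"] assms(3)]
    form_scale_right[OF assms(2,3), of "-1"] by simp

lemma form_sum_phi_right:
  assumes "finite F" "w \<in> H1p"
  shows "a w (\<lambda>x. \<Sum>k\<in>F. c k * phi k x) = (\<Sum>k\<in>F. cnj (c k) * a w (phi k))"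
  using assms(1)
proof (induction F rule: finite_induct)
  case empty
  show ?case using form_scale_right[OF zero_H1p assms(2), of 0] by simp
next
  case (insert k F)
  have "(\<lambda>x. \<Sum>k\<in>F. c k * phi k x) \<in> H1p"
    using V_span_H1p[OF V_spanI[OF insert(1) subset_UNIV]] .
  from form_add_right[OF H1p_scale[OF phi_H1p] this assms(2)] insert
  show ?case by (simp add: form_scale_right[OF phi_H1p assms(2)])
qed

lemma energy_bounds:
  assumes v: "v \<in> H1p"
  shows "\<alpha>lo * H1sq v \<le> energy v" "energy v \<le> \<alpha>up * H1sq v"
proof -
  have E: "energy v = (\<Sum>j\<in>UNIV. Re (wip \<nu> (weak_pderiv j v) (weak_pderiv j v))) + Re (wip \<sigma> v v)"
    unfolding energy_def form_a_eq_wip[OF v v] by simp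
  have nn: "0 \<le> sqint (lebesgue_on Omega) g" for g :: "real^'d \<Rightarrow> complex" by (rule sqint_nonneg)
  have "\<alpha>lo * H1sq v = (\<Sum>j\<in>UNIV. \<alpha>lo * sqint (lebesgue_on Omega) (weak_pderiv j v)) + \<alpha>lo * sqint (lebesgue_on Omega) v"
    by (simp add: H1sq_def distrib_left sum_distrib_left)
  also have "\<dots> \<le> energy v" unfolding E
    by (intro add_mono sum_mono order_trans[OF mult_right_mono[OF _ nn] wip_self(1)[OF coeff_\<nu>]]
        order_trans[OF mult_right_mono[OF _ nn] wip_self(1)[OF coeff_\<sigma>]] weak_pderiv_L2 v H1p_imp_L2)
       (auto simp: \<alpha>lo_def)
  finally show "\<alpha>lo * H1sq v \<le> energy v" .
  have "energy v \<le> (\<Sum>j\<in>UNIV. \<alpha>up * sqint (lebesgue_on Omega) (weak_pderiv j v)) + \<alpha>up * sqint (lebesgue_on Omega) v"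
    unfolding E
    by (intro add_mono sum_mono order_trans[OF wip_self(2)[OF coeff_\<nu>] mult_right_mono[OF _ nn]]
        order_trans[OF wip_self(2)[OF coeff_\<sigma>] mult_right_mono[OF _ nn]] weak_pderiv_L2 v H1p_imp_L2)
       (auto simp: \<alpha>up_def)
  also have "\<dots> = \<alpha>up * H1sq v"
    by (simp add: H1sq_def distrib_left sum_distrib_left)
  finally show "energy v \<le> \<alpha>up * H1sq v" .
qed

lemma energy_nonneg: "v \<in> H1p \<Longrightarrow> energy v \<ge> 0"
  using energy_bounds(1)[of v] H1sq_nonneg[of v] \<alpha>_bounds(1)
  by (meson less_imp_le mult_nonneg_nonneg order_trans)

lemma energy_diff:
  assumes "u \<in> H1p" "v \<in> H1p"
  shows "energy (\<lambda>x. u x - v x) = energy u - 2 * Re (a u v) + energy v"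
  unfolding energy_def using assms form_commute[OF assms]
  by (simp add: form_diff_left form_diff_right H1p_diff)

lemma energy_scale: "v \<in> H1p \<Longrightarrow> energy (\<lambda>x. c * v x) = (cmod c)\<^sup>2 * energy v"
proof -
  assume v: "v \<in> H1p"
  have "a (\<lambda>x. c * v x) (\<lambda>x. c * v x) = (c * cnj c) * a v v"
    by (simp add: form_scale_left form_scale_right v H1p_scale)
  also have "c * cnj c = of_real ((cmod c)\<^sup>2)" by (rule complex_norm_square[symmetric])
  finally show ?thesis unfolding energy_def by simp
qed

end

section \<open>Residuals in the dual norm\<close>

lemma weight_pos: "weight k > 0"
  unfolding weight_def by (smt (verit) sum_nonneg zero_le_power2)

lemma H1sq_sum_phi:
  assumes "finite F"
  shows "H1sq (\<lambda>x. \<Sum>k\<in>F. c k * phi k x) = (\<Sum>k\<in>F. weight k * (cmod (c k))\<^sup>2)"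
proof -
  let ?v = "\<lambda>x. \<Sum>k\<in>F. c k * phi k x"
  have "((\<lambda>k. weight k * (cmod (fcoeff ?v k))\<^sup>2) has_sum H1sq ?v) UNIV"
    by (rule has_sum_H1sq[OF V_span_H1p[OF V_spanI[OF assms subset_UNIV]]])
  moreover have "((\<lambda>k. weight k * (cmod (fcoeff ?v k))\<^sup>2) has_sum (\<Sum>k\<in>F. weight k * (cmod (c k))\<^sup>2)) UNIV"
  proof (rule has_sum_cong_neutral[THEN iffD1])
    show "((\<lambda>k. weight k * (cmod (c k))\<^sup>2) has_sum (\<Sum>k\<in>F. weight k * (cmod (c k))\<^sup>2)) F"
      by (rule has_sum_finite[OF assms])
  qed (auto simp: fcoeff_sum_phi[OF assms])
  ultimately show ?thesis by (rule has_sum_unique)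
qed

lemma proj_V_span: "finite F \<Longrightarrow> proj F v \<in> V_span F"
  unfolding proj_def[abs_def] by (rule V_spanI) auto

lemma H1sq_diff_proj:
  assumes "finite F" "v \<in> H1p"
  shows "H1sq (\<lambda>x. v x - proj F v x) = H1sq v - (\<Sum>k\<in>F. weight k * (cmod (fcoeff v k))\<^sup>2)"
proof -
  have p: "proj F v \<in> H1p" by (rule V_span_H1p[OF proj_V_span[OF assms(1)]])
  have coeff: "fcoeff (\<lambda>x. v x - proj F v x) k = (if k \<in> F then 0 else fcoeff v k)" for k
    using fcoeff_diff[OF H1p_imp_L2[OF assms(2)] H1p_imp_L2[OF p], of k]
    by (simp add: proj_def[abs_def] fcoeff_sum_phi[OF assms(1)])
  have "((\<lambda>k. weight k * (cmod (fcoeff v k))\<^sup>2) has_sum (H1sq v - (\<Sum>k\<in>F. weight k * (cmod (fcoeff v k))\<^sup>2))) (UNIV - F)"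
    by (intro has_sum_Diff has_sum_H1sq has_sum_finite assms) auto
  then have "((\<lambda>k. weight k * (cmod (fcoeff (\<lambda>x. v x - proj F v x) k))\<^sup>2) has_sum (H1sq v - (\<Sum>k\<in>F. weight k * (cmod (fcoeff v k))\<^sup>2))) UNIV"
    by (rule has_sum_cong_neutral[THEN iffD1, rotated -1]) (auto simp: coeff)
  with has_sum_H1sq[OF H1p_diff[OF assms(2) p]] show ?thesis by (rule has_sum_unique)
qed

lemma proj_approximates:
  assumes "v \<in> H1p" "\<epsilon> > 0"
  obtains F where "finite F" "H1sq (\<lambda>x. v x - proj F v x) \<le> \<epsilon>"
proof -
  from has_sum_finite_approximation[OF has_sum_H1sq[OF assms(1)] assms(2)]
  obtain F where "finite F" "dist (\<Sum>k\<in>F. weight k * (cmod (fcoeff v k))\<^sup>2) (H1sq v) \<le> \<epsilon>" by blast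
  then show thesis
    using that[of F] H1sq_diff_proj[OF _ assms(1), of F] by (simp add: dist_real_def abs_le_iff)
qed

text \<open>
  The contribution of the modes in \<open>U\<close> to the square of the dual norm of \<open>r\<close>.
\<close>
definition dual_sum :: "((real^'d \<Rightarrow> complex) \<Rightarrow> complex) \<Rightarrow> (int^'d) set \<Rightarrow> real" where
  "dual_sum r U = (\<Sum>k\<in>U. (cmod (r (phi k)))\<^sup>2 / weight k)"

lemma dual_sum_mono: "finite U' \<Longrightarrow> U \<subseteq> U' \<Longrightarrow> dual_sum r U \<le> dual_sum r U'"
  unfolding dual_sum_def by (intro sum_mono2) (auto simp: less_imp_le[OF weight_pos])

lemma dual_sum_nonneg: "dual_sum r U \<ge> 0"
  unfolding dual_sum_def by (intro sum_nonneg) (auto simp: less_imp_le[OF weight_pos])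

lemma Hm1_norm_dual_proj:
  assumes U: "finite U"
  shows "(Hm1_norm (dual_proj U r))\<^sup>2 = dual_sum r U"
proof -
  have "dual_proj U r (phi k) = (if k \<in> U then r (phi k) else 0)" for k
    using U by (simp add: dual_proj_def fcoeff_phi if_distrib[of cnj] if_distrib[of "\<lambda>t. _ * t"] cong: if_cong)
  then have "(\<Sum>\<^sub>\<infinity>k. (cmod (dual_proj U r (phi k)))\<^sup>2 / weight k) = (\<Sum>\<^sub>\<infinity>k\<in>U. (cmod (r (phi k)))\<^sup>2 / weight k)"
    by (intro infsum_cong_neutral) auto
  also have "\<dots> = dual_sum r U" using U by (simp add: dual_sum_def)
  finally show ?thesis using dual_sum_nonneg[of r U] by (simp add: Hm1_norm_def)
qed

lemma Hm1_norm_nonneg: "Hm1_norm r \<ge> 0"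
  unfolding Hm1_norm_def by (auto intro!: infsum_nonneg simp: less_imp_le[OF weight_pos])

lemma bulk_criterion_iff:
  assumes "finite U" "\<theta> \<ge> 0"
  shows "Hm1_norm (dual_proj U r) \<ge> \<theta> * Hm1_norm r \<longleftrightarrow> dual_sum r U \<ge> \<theta>\<^sup>2 * (Hm1_norm r)\<^sup>2"
  unfolding Hm1_norm_dual_proj[OF assms(1), symmetric] power_mult_distrib[symmetric]
  using assms(2) Hm1_norm_nonneg by (subst power2_le_iff_abs_le) auto

context elliptic_form
begin

text \<open>
  Any reduction of the energy of \<open>e\<close> by an element \<open>d\<close> with modes in \<open>U\<close> is paid for by the residual on \<open>U\<close>:
  the reduction is \<open>2 Re a(e,d) - a(d,d)\<close>, by coercivity at most
  \<open>2 Re a(e,d) - \<alpha>lo \<parallel>d\<parallel>\<^sup>2\<close>, and this is maximised mode by mode.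
\<close>
lemma energy_minus_le_dual_sum:
  assumes e: "e \<in> H1p" and d: "d \<in> V_span U" and U: "finite U"
  shows "energy e - energy (\<lambda>x. e x - d x) \<le> dual_sum (a e) U / \<alpha>lo"
proof -
  from d obtain F c where F: "finite F" "F \<subseteq> U" and d_eq: "d = (\<lambda>x. \<Sum>k\<in>F. c k * phi k x)" by (rule V_spanE)
  have dH: "d \<in> H1p" using d by (rule V_span_H1p)
  have am_gm: "2 * Re (cnj z * t) \<le> (cmod t)\<^sup>2 / W / \<alpha>lo + \<alpha>lo * (W * (cmod z)\<^sup>2)" if W: "W > 0" for z t W
  proof -
    define p where "p = \<alpha>lo * W"
    have p: "p > 0" using W \<alpha>_bounds by (simp add: p_def)
    have "2 * Re (cnj z * t) \<le> 2 * (cmod z * cmod t)"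
      using complex_Re_le_cmod[of "cnj z * t"] by (simp add: norm_mult)
    also have "\<dots> \<le> (cmod t)\<^sup>2 / p + p * (cmod z)\<^sup>2"
    proof -
      have "0 \<le> (cmod t - p * cmod z)\<^sup>2 / p" using p by simp
      also have "\<dots> = (cmod t)\<^sup>2 / p - 2 * (cmod z * cmod t) + p * (cmod z)\<^sup>2"
        using p by (simp add: field_simps power2_eq_square)
      finally show ?thesis by simp
    qed
    finally show ?thesis by (simp add: p_def mult_ac)
  qed
  have "energy e - energy (\<lambda>x. e x - d x) = 2 * Re (a e d) - energy d"
    by (simp add: energy_diff[OF e dH])
  also have "\<dots> \<le> 2 * Re (a e d) - \<alpha>lo * H1sq d" using energy_bounds(1)[OF dH] by simp
  also have "\<dots> = (\<Sum>k\<in>F. 2 * Re (cnj (c k) * a e (phi k)) - \<alpha>lo * (weight k * (cmod (c k))\<^sup>2))"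
    unfolding d_eq form_sum_phi_right[OF F(1) e] H1sq_sum_phi[OF F(1)]
    by (simp add: sum_subtractf sum_distrib_left)
  also have "\<dots> \<le> (\<Sum>k\<in>F. (cmod (a e (phi k)))\<^sup>2 / weight k / \<alpha>lo)"
    by (intro sum_mono) (use am_gm[OF weight_pos] in \<open>smt (verit)\<close>)
  also have "\<dots> = dual_sum (a e) F / \<alpha>lo" by (simp add: dual_sum_def sum_divide_distrib)
  also have "\<dots> \<le> dual_sum (a e) U / \<alpha>lo"
    using \<alpha>_bounds(1) by (intro divide_right_mono dual_sum_mono F U) auto
  finally show ?thesis .
qed

text \<open>
  The element \<open>v\<close> is the Riesz representative of the functional \<open>a(d, \<cdot>)\<close> restricted to \<open>U\<close>, so that both
  \<open>a(d,v)\<close> and \<open>\<parallel>v\<parallel>\<^sup>2\<close> equal the dual sum \<open>S\<close>. Nonnegativity of the energy of \<open>d - t v\<close> at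
  \<open>t = 1/\<alpha>up\<close> gives the bound.
\<close>
lemma dual_sum_le_energy:
  assumes d: "d \<in> H1p" and U: "finite U"
  shows "dual_sum (a d) U \<le> \<alpha>up * energy d"
proof -
  define S where "S = dual_sum (a d) U"
  define c where "c k = a d (phi k) / of_real (weight k)" for k
  define v where "v = (\<lambda>x. \<Sum>k\<in>U. c k * phi k x)"
  define t where "t = 1 / \<alpha>up"
  have v: "v \<in> H1p" unfolding v_def by (rule V_span_H1p[OF V_spanI[OF U subset_UNIV]])
  have w0: "weight k \<noteq> 0" for k :: "int^'d" using weight_pos[of k] by simp
  have dv: "a d v = of_real S"
  proof -
    have "cnj (c k) * a d (phi k) = of_real ((cmod (a d (phi k)))\<^sup>2 / weight k)" for k
      by (simp add: c_def complex_norm_square mult.commute del: of_real_power)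
    then show ?thesis unfolding v_def form_sum_phi_right[OF U d] by (simp add: S_def dual_sum_def)
  qed
  have vv: "H1sq v = S"
  proof -
    have "weight k * (cmod (c k))\<^sup>2 = (cmod (a d (phi k)))\<^sup>2 / weight k" for k
      using weight_pos[of k] by (simp add: c_def norm_divide power_divide power2_eq_square)
    then show ?thesis unfolding v_def H1sq_sum_phi[OF U] by (simp add: S_def dual_sum_def)
  qed
  have "0 \<le> energy (\<lambda>x. d x - of_real t * v x)" by (intro energy_nonneg H1p_diff H1p_scale d v)
  also have "\<dots> = energy d - 2 * Re (cnj (of_real t) * a d v) + (cmod (of_real t))\<^sup>2 * energy v"
    by (simp only: energy_diff[OF d H1p_scale[OF v]] energy_scale[OF v] form_scale_right[OF v d])
  also have "\<dots> = energy d - 2 * t * S + t\<^sup>2 * energy v" by (simp add: dv)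
  also have "\<dots> \<le> energy d - 2 * t * S + t\<^sup>2 * (\<alpha>up * S)"
    using energy_bounds(2)[OF v] by (intro add_left_mono mult_left_mono) (auto simp: vv)
  also have "\<dots> = energy d - S / \<alpha>up"
    using \<alpha>_bounds(3) by (simp add: t_def power2_eq_square)
  finally show ?thesis using \<alpha>_bounds(3) by (simp add: S_def field_simps)
qed

text \<open>
  The equivalence of the dual norm of the residual with the energy norm of the error. The lower bound is
  \<open>energy_minus_le_dual_sum\<close> applied to the Fourier truncations of \<open>e\<close>, whose distance to \<open>e\<close> tends to zero.
\<close>
lemma Hm1_norm_residual:
  assumes e: "e \<in> H1p" and r: "\<And>k. r (phi k) = a e (phi k)"
  shows "(Hm1_norm r)\<^sup>2 \<le> \<alpha>up * energy e" "\<alpha>lo * energy e \<le> (Hm1_norm r)\<^sup>2"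
proof -
  let ?g = "\<lambda>k. (cmod (a e (phi k)))\<^sup>2 / weight k"
  have nn: "?g k \<ge> 0" for k using weight_pos[of k] by simp
  have bd: "sum ?g F \<le> \<alpha>up * energy e" if "finite F" for F
    using dual_sum_le_energy[OF e that] by (simp add: dual_sum_def)
  have summ: "?g summable_on UNIV"
    by (rule nonneg_bdd_above_summable_on) (auto intro!: bdd_aboveI2 bd nn)
  have N: "(Hm1_norm r)\<^sup>2 = infsum ?g UNIV"
    using infsum_nonneg[of UNIV ?g] nn by (simp add: Hm1_norm_def r)
  show "(Hm1_norm r)\<^sup>2 \<le> \<alpha>up * energy e"
    unfolding N by (rule infsum_le_finite_sums[OF summ bd]) auto
  have "energy e \<le> infsum ?g UNIV / \<alpha>lo"
  proof (rule field_le_epsilon)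
    fix \<epsilon> :: real assume "\<epsilon> > 0"
    then have "\<epsilon> / \<alpha>up > 0" using \<alpha>_bounds by simp
    then obtain F where F: "finite F" "H1sq (\<lambda>x. e x - proj F e x) \<le> \<epsilon> / \<alpha>up"
      by (rule proj_approximates[OF e])
    have "energy (\<lambda>x. e x - proj F e x) \<le> \<alpha>up * H1sq (\<lambda>x. e x - proj F e x)"
      by (intro energy_bounds H1p_diff e V_span_H1p[OF proj_V_span[OF F(1)]])
    also have "\<dots> \<le> \<epsilon>" using F(2) \<alpha>_bounds(3) by (simp add: field_simps)
    finally have "energy e - \<epsilon> \<le> dual_sum (a e) F / \<alpha>lo"
      using energy_minus_le_dual_sum[OF e proj_V_span[OF F(1)] F(1), of e] by simp
    also have "\<dots> \<le> infsum ?g UNIV / \<alpha>lo"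
      unfolding dual_sum_def using \<alpha>_bounds(1) nn
      by (intro divide_right_mono finite_sum_le_infsum summ F) auto
    finally show "energy e \<le> infsum ?g UNIV / \<alpha>lo + \<epsilon>" by simp
  qed
  then show "\<alpha>lo * energy e \<le> (Hm1_norm r)\<^sup>2"
    unfolding N using \<alpha>_bounds(1) by (simp add: field_simps)
qed

section \<open>One step of the adaptive algorithm\<close>

text \<open>
  Here \<open>e\<close> and \<open>e'\<close> are the errors before and after the step and \<open>e'\<close> is Galerkin orthogonal. Hence the
  energy drops by exactly the energy of \<open>d = e - e'\<close>, and on \<open>U\<close> the functionals \<open>a(d, \<cdot>)\<close> and
  \<open>a(e, \<cdot>) = r\<close> agree. The energy of \<open>d\<close> is therefore at least a fixed multiple of the marked part of the
  residual.
\<close>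
lemma energy_contraction:
  assumes e: "e \<in> H1p" and e': "e' \<in> H1p" and \<delta>: "(\<lambda>x. e x - e' x) \<in> V_span U" and U: "finite U" "D \<subseteq> U"
    and orth: "\<And>v. v \<in> V_span U \<Longrightarrow> a e' v = 0"
    and r: "\<And>k. r (phi k) = a e (phi k)"
    and D: "Hm1_norm (dual_proj D r) \<ge> \<theta> * Hm1_norm r" and \<theta>: "\<theta> \<ge> 0"
  shows "energy e' \<le> (1 - \<alpha>lo / \<alpha>up * \<theta>\<^sup>2) * energy e"
proof -
  define d where "d = (\<lambda>x. e x - e' x)"
  have dH: "d \<in> H1p" unfolding d_def by (intro H1p_diff e e')
  have fD: "finite D" using U finite_subset by blast
  have "a e' d = 0" using orth \<delta> by (simp add: d_def)
  then have "a e e' = a e' e'"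
    using form_diff_right[OF e e' e'] form_commute[OF e e'] form_commute[OF e' e'] by (simp add: d_def) (metis complex_cnj_cnj)
  then have pyth: "energy d = energy e - energy e'"
    unfolding d_def energy_diff[OF e e'] by (simp add: energy_def)
  have eq: "a d (phi k) = r (phi k)" if "k \<in> U" for k
    unfolding d_def using form_diff_left[OF e e' phi_H1p] orth[OF V_span_phi[OF that]] r by simp
  have "\<alpha>lo * energy e * \<theta>\<^sup>2 \<le> (Hm1_norm r)\<^sup>2 * \<theta>\<^sup>2"
    by (intro mult_right_mono Hm1_norm_residual(2) e r) simp
  also have "\<dots> \<le> dual_sum r D" using D bulk_criterion_iff[OF fD \<theta>] by (simp add: mult.commute)
  also have "\<dots> \<le> dual_sum r U" by (intro dual_sum_mono U)
  also have "\<dots> = dual_sum (a d) U" by (simp add: dual_sum_def eq)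
  also have "\<dots> \<le> \<alpha>up * (energy e - energy e')" using dual_sum_le_energy[OF dH U(1)] by (simp add: pyth)
  finally show ?thesis using \<alpha>_bounds(3) by (simp add: field_simps)
qed

text \<open>
  Approximating \<open>e\<close> well by elements with modes in \<open>\<Lambda> \<union> U\<close> forces the residual to be concentrated on
  \<open>\<Lambda> \<union> U\<close>. Galerkin orthogonality makes it vanish on \<open>\<Lambda>\<close>, so it is concentrated on \<open>U\<close> itself.
\<close>
lemma optimal_marking:
  assumes e: "e \<in> H1p" and d: "d \<in> V_span (\<Lambda> \<union> U)" and fin: "finite \<Lambda>" "finite U"
    and orth: "\<And>v. v \<in> V_span \<Lambda> \<Longrightarrow> a e v = 0"
    and r: "\<And>k. r (phi k) = a e (phi k)"
    and red: "energy (\<lambda>x. e x - d x) \<le> \<mu> * energy e"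
    and \<mu>: "\<mu> \<le> 1 - \<alpha>up / \<alpha>lo * \<theta>\<^sup>2" and \<theta>: "\<theta> \<ge> 0"
  shows "Hm1_norm (dual_proj U r) \<ge> \<theta> * Hm1_norm r"
proof -
  have "dual_sum (a e) (\<Lambda> \<union> U) = dual_sum (a e) U"
    unfolding dual_sum_def using fin orth[OF V_span_phi] by (intro sum.mono_neutral_right) auto
  moreover have "dual_sum (a e) U = dual_sum r U" by (simp add: dual_sum_def r)
  ultimately have "(1 - \<mu>) * energy e \<le> dual_sum r U / \<alpha>lo"
    using energy_minus_le_dual_sum[OF e d] fin red by (simp add: left_diff_distrib)
  moreover have "\<alpha>up / \<alpha>lo * \<theta>\<^sup>2 * energy e \<le> (1 - \<mu>) * energy e"
    using \<mu> by (intro mult_right_mono energy_nonneg e) auto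
  ultimately have "\<theta>\<^sup>2 * (\<alpha>up * energy e) \<le> dual_sum r U"
    using \<alpha>_bounds(1) by (simp add: field_simps)
  moreover have "\<theta>\<^sup>2 * (Hm1_norm r)\<^sup>2 \<le> \<theta>\<^sup>2 * (\<alpha>up * energy e)"
    by (intro mult_left_mono Hm1_norm_residual(1) e r) simp
  ultimately show ?thesis using bulk_criterion_iff[OF fin(2) \<theta>] by simp
qed

text \<open>
  The initial step fits the general pattern: \<open>0\<close> is the Galerkin solution on the empty set of modes,
  and \<open>f\<close> coincides with the residual \<open>a(u, \<cdot>)\<close> on \<open>H1p\<close>.
\<close>
lemma adfour_invariant:
  assumes run: "adfour \<nu> \<sigma> f \<theta> tol \<Lambda> w r N" and sol: "solution \<nu> \<sigma> f u" and "n \<le> N"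
  shows "finite (\<Lambda> n) \<and> w n \<in> V_span (\<Lambda> n) \<and> (\<forall>v\<in>V_span (\<Lambda> n). a (\<lambda>x. u x - w n x) v = 0)
     \<and> (\<forall>v\<in>H1p. r n v = a (\<lambda>x. u x - w n x) v)"
proof -
  have u: "u \<in> H1p" and sol': "\<And>v. v \<in> H1p \<Longrightarrow> a u v = f v" using sol by (auto simp: solution_def)
  show ?thesis using \<open>n \<le> N\<close>
  proof (induction n)
    case 0
    have init: "\<Lambda> 0 = {}" "w 0 = (\<lambda>x. 0)" "r 0 = f" using run by (auto simp: adfour_def)
    have "v = (\<lambda>x. 0)" if "v \<in> V_span {}" for v :: "real^'d \<Rightarrow> complex"
      using that by (auto elim: V_spanE)
    moreover have "a u (\<lambda>x. 0) = 0" using form_scale_right[OF zero_H1p u, of 0] by simp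
    ultimately show ?case
      unfolding init using sol' by (auto simp: V_span_zero)
  next
    case (Suc n)
    then have n: "n < N" and IH: "finite (\<Lambda> n)" by auto
    from run n obtain D where D: "doerfler (r n) \<theta> D" "\<Lambda> (Suc n) = \<Lambda> n \<union> D"
      and gal: "galerkin \<nu> \<sigma> f (\<Lambda> (Suc n)) (w (Suc n))" and res: "r (Suc n) = residual \<nu> \<sigma> f (w (Suc n))"
      unfolding adfour_def by blast
    have w: "w (Suc n) \<in> V_span (\<Lambda> (Suc n))" "\<And>v. v \<in> V_span (\<Lambda> (Suc n)) \<Longrightarrow> a (w (Suc n)) v = f v"
      using gal by (auto simp: galerkin_def)
    have diff: "a (\<lambda>x. u x - w (Suc n) x) v = f v - a (w (Suc n)) v" if "v \<in> H1p" for v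
      using form_diff_left[OF u V_span_H1p[OF w(1)] that] sol'[OF that] by simp
    show ?case
      using IH D w diff by (auto simp: doerfler_def res residual_def V_span_H1p)
  qed
qed

end

section \<open>Optimal cardinality\<close>

lemma powr_less_one_base: "0 < x \<Longrightarrow> x < 1 \<Longrightarrow> 0 < p \<Longrightarrow> x powr p < 1" for x p :: real
  using powr_less_mono2[of p x 1] by simp

lemma H1_norm_nonneg: "H1_norm v \<ge> 0"
  unfolding H1_norm_def by (auto intro!: infsum_nonneg simp: less_imp_le[OF weight_pos])

lemma index_sets_of_card_nonempty: "{\<Lambda> :: (int^'d) set. finite \<Lambda> \<and> card \<Lambda> = N} \<noteq> {}"
proof -
  have "infinite (UNIV :: (int^'d) set)"
  proof
    assume "finite (UNIV :: (int^'d) set)"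
    then have "finite (range (\<lambda>m::int. (\<chi> j. m) :: int^'d))" by (rule finite_subset[rotated]) simp
    moreover have "inj (\<lambda>m::int. (\<chi> j. m) :: int^'d)" by (auto simp: inj_def vec_eq_iff)
    ultimately show False using finite_imageD infinite_UNIV_int by blast
  qed
  then show ?thesis using infinite_arbitrarily_large[of UNIV N] by auto
qed

lemma best_error_nonneg: "best_error N v \<ge> 0"
  unfolding best_error_def by (rule cINF_greatest[OF index_sets_of_card_nonempty H1_norm_nonneg])

lemma H1_norm_le_AsB_norm:
  fixes v :: "real^'d \<Rightarrow> complex"
  assumes "v \<in> AsB s"
  shows "H1_norm v \<le> AsB_norm s v"
proof -
  have "bdd_above ((\<lambda>N. best_error N v * real N powr (s / real CARD('d))) ` {1..})"
    using assms by (simp add: AsB_def)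
  then have "best_error 1 v * real 1 powr (s / real CARD('d))
      \<le> (SUP N\<in>{1..}. best_error N v * real N powr (s / real CARD('d)))"
    by (intro cSUP_upper) auto
  then show ?thesis using best_error_nonneg[of 1 v] by (simp add: AsB_norm_def)
qed

text \<open>
  The cardinality is the least integer strictly above \<open>X = (\<parallel>u\<parallel>\<^sub>A / \<epsilon>)\<close> to the power \<open>d/s\<close>. Strictness
  keeps the best error below \<open>\<epsilon>\<close>, so that some set realises an error below \<open>\<epsilon>\<close> even if the infimum is
  not attained. The bound \<open>\<epsilon> \<le> \<parallel>u\<parallel>\<^sub>A\<close> gives \<open>X \<ge> 1\<close>, so rounding up costs at most a factor 2.
\<close>
lemma AsB_approximation:
  fixes u :: "real^'d \<Rightarrow> complex"
  assumes u: "u \<in> AsB s" and s: "s > 0" and \<epsilon>: "0 < \<epsilon>" "\<epsilon> \<le> AsB_norm s u"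
  obtains \<Lambda> where "finite \<Lambda>" "H1_norm (\<lambda>x. u x - proj \<Lambda> u x) < \<epsilon>"
    "real (card \<Lambda>) \<le> 2 * (AsB_norm s u / \<epsilon>) powr (real CARD('d) / s)"
proof -
  define M p where "M = AsB_norm s u" and "p = real CARD('d) / s"
  define X where "X = (M / \<epsilon>) powr p"
  define N where "N = nat \<lfloor>X\<rfloor> + 1"
  have p: "p > 0" "s / real CARD('d) = 1 / p" using s by (auto simp: p_def)
  have M: "M > 0" "M / \<epsilon> \<ge> 1" using \<epsilon> by (auto simp: M_def field_simps)
  have X: "X \<ge> 1" unfolding X_def using M p by (intro ge_one_powr_ge_zero) auto
  have N: "X < real N" "real N \<le> 2 * X" "N \<ge> 1" using X unfolding N_def by linarith+
  have bdd: "bdd_above ((\<lambda>N. best_error N u * real N powr (1 / p)) ` {1..})"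
    using u p by (simp add: AsB_def)
  have "best_error N u * real N powr (1 / p) \<le> (SUP N\<in>{1..}. best_error N u * real N powr (1 / p))"
    using N by (intro cSUP_upper bdd) auto
  also have "\<dots> \<le> M"
    using H1_norm_nonneg[of u] by (simp add: M_def AsB_norm_def p)
  finally have "best_error N u * real N powr (1 / p) \<le> M" .
  moreover have "M < \<epsilon> * real N powr (1 / p)"
  proof -
    have "X powr (1 / p) = M / \<epsilon>" using p M \<epsilon> by (simp add: X_def powr_powr)
    moreover have "X powr (1 / p) < real N powr (1 / p)" using X N p by (intro powr_less_mono2) auto
    ultimately have "M / \<epsilon> < real N powr (1 / p)" by simp
    then show ?thesis using \<epsilon>(1) by (simp add: pos_divide_less_eq mult.commute)
  qed
  ultimately have "best_error N u * real N powr (1 / p) < \<epsilon> * real N powr (1 / p)" by linarith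
  then have less: "best_error N u < \<epsilon>" using N(3) by (simp add: mult_less_cancel_right)
  let ?S = "{\<Lambda> :: (int^'d) set. finite \<Lambda> \<and> card \<Lambda> = N}"
  have ne: "?S \<noteq> {}" by (rule index_sets_of_card_nonempty)
  from less obtain y where "y \<in> (\<lambda>\<Lambda>. H1_norm (\<lambda>x. u x - proj \<Lambda> u x)) ` ?S" "y < \<epsilon>"
    using cInf_lessD[OF _ less[unfolded best_error_def]] ne by blast
  then obtain \<Lambda> where "finite \<Lambda>" "card \<Lambda> = N" "H1_norm (\<lambda>x. u x - proj \<Lambda> u x) < \<epsilon>" by auto
  then show thesis using that[of \<Lambda>] N(2) by (simp add: X_def M_def p_def)
qed

context elliptic_form
begin

text \<open>
  The bound reproduces itself. With \<open>\<kappa> = \<rho> powr p\<close> and \<open>E\<^sub>n\<close> the energy of the \<open>n\<close>-th error, step \<open>n\<close> adds at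
  most \<open>A E\<^sub>n powr (-p/2)\<close> modes, and \<open>E\<^sub>n\<^sub>+\<^sub>1 \<le> \<rho>\<^sup>2 E\<^sub>n\<close> turns \<open>E\<^sub>n powr (-p/2)\<close> into at most
  \<open>\<kappa> E\<^sub>n\<^sub>+\<^sub>1 powr (-p/2)\<close>. The factor \<open>K = A \<kappa> / (1 - \<kappa>)\<close> solves \<open>(K + A) \<kappa> = K\<close>; it is the sum of
  the geometric series of all steps.
  The energy is also shown to stay below that of \<open>u\<close>, which keeps the tolerance passed to
  \<open>AsB_approximation\<close> below \<open>\<parallel>u\<parallel>\<^sub>A\<close>.
\<close>
lemma cardinality_bound:
  assumes run: "adfour \<nu> \<sigma> f \<theta> tol \<Lambda> w r N" and sol: "solution \<nu> \<sigma> f u" and u: "u \<in> AsB s" and s: "s > 0"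
    and \<theta>: "\<theta> > 0" and \<mu>: "0 < \<mu>" "\<mu> \<le> 1 - \<alpha>up / \<alpha>lo * \<theta>\<^sup>2"
    and p: "p = real CARD('d) / s" and \<rho>: "\<rho> = sqrt (1 - \<alpha>lo / \<alpha>up * \<theta>\<^sup>2)" "0 < \<rho>" "\<rho> < 1"
    and n: "n \<le> N" and pos: "energy (\<lambda>x. u x - w n x) > 0"
  shows "energy (\<lambda>x. u x - w n x) \<le> energy u \<and>
     real (card (\<Lambda> n)) \<le> 2 * (AsB_norm s u * sqrt (\<alpha>up / \<mu>)) powr p * (\<rho> powr p / (1 - \<rho> powr p))
             * energy (\<lambda>x. u x - w n x) powr (- (p / 2))"
  using n pos
proof (induction n)
  case 0
  have init: "\<Lambda> 0 = {}" "w 0 = (\<lambda>x. 0)" using run by (auto simp: adfour_def)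
  have "\<rho> powr p < 1" using \<rho>(2,3) p s by (intro powr_less_one_base) auto
  then show ?case by (simp add: init)
next
  case (Suc n)
  define e where "e m = (\<lambda>x. u x - w m x)" for m
  define \<kappa> where "\<kappa> = \<rho> powr p"
  define A where "A = 2 * (AsB_norm s u * sqrt (\<alpha>up / \<mu>)) powr p"
  have p0: "p > 0" using p s by simp
  have \<kappa>: "0 < \<kappa>" "\<kappa> < 1" unfolding \<kappa>_def using \<rho>(2,3) p0 by (auto intro: powr_less_one_base)
  have uH: "u \<in> H1p" using sol by (simp add: solution_def)
  have n: "n < N" "n \<le> N" "Suc n \<le> N" using Suc.prems by auto
  note inv = adfour_invariant[OF run sol n(2), folded e_def] adfour_invariant[OF run sol n(3), folded e_def]
  have wH: "w n \<in> H1p" "w (Suc n) \<in> H1p" using inv V_span_H1p by auto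
  then have eH: "e n \<in> H1p" "e (Suc n) \<in> H1p" unfolding e_def using uH H1p_diff by auto
  have rphi: "r n (phi k) = a (e n) (phi k)" for k using inv(1) phi_H1p by blast
  from run n obtain D where D: "doerfler (r n) \<theta> D" "\<Lambda> (Suc n) = \<Lambda> n \<union> D" unfolding adfour_def by blast
  have sub: "\<Lambda> n \<subseteq> \<Lambda> (Suc n)" "D \<subseteq> \<Lambda> (Suc n)" using D by auto
  have "energy (e (Suc n)) \<le> (1 - \<alpha>lo / \<alpha>up * \<theta>\<^sup>2) * energy (e n)"
  proof (rule energy_contraction[OF eH _ _ sub(2) _ rphi])
    have "(\<lambda>x. e n x - e (Suc n) x) = (\<lambda>x. w (Suc n) x - w n x)" by (auto simp: e_def)
    moreover have "w n \<in> V_span (\<Lambda> (Suc n))" using inv(1) V_span_mono[OF sub(1)] by auto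
    ultimately show "(\<lambda>x. e n x - e (Suc n) x) \<in> V_span (\<Lambda> (Suc n))"
      using inv(2) by (simp add: V_span_diff)
    show "\<theta> * Hm1_norm (r n) \<le> Hm1_norm (dual_proj D (r n))" using D by (simp add: doerfler_def)
  qed (use inv \<theta> in auto)
  also have "1 - \<alpha>lo / \<alpha>up * \<theta>\<^sup>2 = \<rho>\<^sup>2" using \<rho> by (simp add: real_sqrt_gt_0_iff)
  finally have contr: "energy (e (Suc n)) \<le> \<rho>\<^sup>2 * energy (e n)" .
  have pos': "energy (e (Suc n)) > 0" using Suc.prems by (simp add: e_def)
  with contr have pos: "energy (e n) > 0"
    by (smt (verit) mult_nonneg_nonpos zero_le_power2)
  from Suc.IH[OF n(2)] pos have IH: "energy (e n) \<le> energy u"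
    "real (card (\<Lambda> n)) \<le> A * (\<kappa> / (1 - \<kappa>)) * energy (e n) powr (- (p / 2))"
    by (auto simp: e_def A_def \<kappa>_def)
  have "\<rho>\<^sup>2 * energy (e n) \<le> 1 * energy (e n)"
    using \<rho>(2,3) pos by (intro mult_right_mono) (auto simp: power_le_one_iff)
  with contr IH(1) have le_u: "energy (e (Suc n)) \<le> energy u" by linarith
  \<comment> \<open>The \<open>H\<^sup>1\<close> tolerance for which the energy of the approximation error is at most \<open>\<mu>\<close> times that of \<open>e n\<close>.\<close>
  define \<epsilon> where "\<epsilon> = sqrt (\<mu> / \<alpha>up * energy (e n))"
  have \<epsilon>_pos: "\<epsilon> > 0" unfolding \<epsilon>_def using pos \<mu>(1) \<alpha>_bounds by simp
  have \<mu>1: "\<mu> < 1" using \<mu> \<theta> \<alpha>_bounds by (smt (verit) divide_pos_pos mult_pos_pos zero_less_power)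
  have "\<epsilon> \<le> sqrt (H1sq u)"
  proof -
    have "\<mu> / \<alpha>up * energy (e n) \<le> 1 / \<alpha>up * (\<alpha>up * H1sq u)"
      using IH(1) energy_bounds(2)[OF uH] \<mu>1 \<alpha>_bounds pos \<mu>(1)
      by (intro mult_mono divide_right_mono) auto
    then show ?thesis using \<alpha>_bounds(3) by (simp add: \<epsilon>_def)
  qed
  then have \<epsilon>_le: "\<epsilon> \<le> AsB_norm s u" using H1_norm_le_AsB_norm[OF u] H1_norm_eq[OF uH] by simp
  obtain \<Lambda>' where \<Lambda>': "finite \<Lambda>'" "H1_norm (\<lambda>x. u x - proj \<Lambda>' u x) < \<epsilon>"
    "real (card \<Lambda>') \<le> 2 * (AsB_norm s u / \<epsilon>) powr p"
    using AsB_approximation[OF u s \<epsilon>_pos \<epsilon>_le] unfolding p by blast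
  have pH: "(\<lambda>x. u x - proj \<Lambda>' u x) \<in> H1p" by (intro H1p_diff uH V_span_H1p[OF proj_V_span[OF \<Lambda>'(1)]])
  have "Hm1_norm (dual_proj \<Lambda>' (r n)) \<ge> \<theta> * Hm1_norm (r n)"
  proof (rule optimal_marking[OF eH(1) _ _ \<Lambda>'(1) _ rphi])
    show "(\<lambda>x. proj \<Lambda>' u x - w n x) \<in> V_span (\<Lambda> n \<union> \<Lambda>')"
      using inv(1) proj_V_span[OF \<Lambda>'(1), of u] V_span_mono[of "\<Lambda> n" "\<Lambda> n \<union> \<Lambda>'"] V_span_mono[of \<Lambda>' "\<Lambda> n \<union> \<Lambda>'"]
      by (intro V_span_diff) auto
    have "energy (\<lambda>x. e n x - (proj \<Lambda>' u x - w n x)) = energy (\<lambda>x. u x - proj \<Lambda>' u x)"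
      by (simp add: e_def)
    also have "\<dots> \<le> \<alpha>up * H1sq (\<lambda>x. u x - proj \<Lambda>' u x)" by (rule energy_bounds(2)[OF pH])
    also have "\<dots> \<le> \<alpha>up * (\<mu> / \<alpha>up * energy (e n))"
      using \<Lambda>'(2) \<alpha>_bounds(3) unfolding H1_norm_eq[OF pH] \<epsilon>_def real_sqrt_less_iff
      by (intro mult_left_mono) auto
    also have "\<dots> = \<mu> * energy (e n)" using \<alpha>_bounds(3) by simp
    finally show "energy (\<lambda>x. e n x - (proj \<Lambda>' u x - w n x)) \<le> \<mu> * energy (e n)" .
  qed (use inv \<theta> \<mu> in auto)
  with D(1) \<Lambda>'(1) have "card D \<le> card \<Lambda>'" unfolding doerfler_def by blast
  moreover have "card (\<Lambda> (Suc n)) \<le> card (\<Lambda> n) + card D" unfolding D(2) by (rule card_Un_le)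
  ultimately have "real (card (\<Lambda> (Suc n))) \<le> real (card (\<Lambda> n)) + real (card \<Lambda>')" by linarith
  also have "2 * (AsB_norm s u / \<epsilon>) powr p = A * energy (e n) powr (- (p / 2))"
  proof -
    have M0: "AsB_norm s u > 0" using \<epsilon>_pos \<epsilon>_le by linarith
    have "AsB_norm s u / \<epsilon> = (AsB_norm s u * sqrt (\<alpha>up / \<mu>)) * energy (e n) powr (- (1 / 2))"
      using pos \<mu>(1) \<alpha>_bounds(3)
      by (simp add: \<epsilon>_def real_sqrt_mult real_sqrt_divide powr_minus powr_half_sqrt field_simps)
    then show ?thesis
      using M0 \<mu>(1) \<alpha>_bounds(3) pos by (simp add: A_def powr_mult powr_powr)
  qed
  then have "real (card (\<Lambda> n)) + real (card \<Lambda>')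
      \<le> A * (\<kappa> / (1 - \<kappa>)) * energy (e n) powr (- (p / 2)) + A * energy (e n) powr (- (p / 2))"
    using IH(2) \<Lambda>'(3) by linarith
  also have "\<dots> = A / (1 - \<kappa>) * energy (e n) powr (- (p / 2))"
    using \<kappa> by (simp add: field_simps)
  also have "\<dots> \<le> A / (1 - \<kappa>) * (\<kappa> * energy (e (Suc n)) powr (- (p / 2)))"
  proof (rule mult_left_mono)
    have "energy (e n) powr (- (p / 2)) \<le> (energy (e (Suc n)) / \<rho>\<^sup>2) powr (- (p / 2))"
      using contr pos' p0 \<rho>(2) by (intro powr_mono2') (auto simp: field_simps)
    also have "\<dots> = \<kappa> * energy (e (Suc n)) powr (- (p / 2))"
    proof -
      have "(\<rho>\<^sup>2) powr (- (p / 2)) = \<rho> powr (- p)"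
        using \<rho>(2) by (simp add: powr_powr flip: powr_numeral)
      then show ?thesis using pos' \<rho>(2) by (simp add: powr_divide \<kappa>_def powr_minus field_simps)
    qed
    finally show "energy (e n) powr (- (p / 2)) \<le> \<kappa> * energy (e (Suc n)) powr (- (p / 2))" .
    show "0 \<le> A / (1 - \<kappa>)" using \<kappa> by (simp add: A_def)
  qed
  finally show ?case
    using le_u by (simp add: e_def A_def \<kappa>_def mult.assoc)
qed

end

theorem theorem7p1:
  fixes s :: real
  assumes "s > 0"
  shows "\<exists>C :: real \<Rightarrow> real \<Rightarrow> real \<Rightarrow> real.
    \<forall>(\<nu> :: real^'d \<Rightarrow> real) \<sigma> \<nu>lo \<nu>up \<sigma>lo \<sigma>up f u \<theta> \<mu> tol \<Lambda> w r n.
      let \<alpha>lo = min \<nu>lo \<sigma>lo; \<alpha>up = max \<nu>up \<sigma>up;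
          \<rho> = sqrt (1 - \<alpha>lo / \<alpha>up * \<theta>\<^sup>2)
      in coefficient \<nu> \<nu>lo \<nu>up \<and> coefficient \<sigma> \<sigma>lo \<sigma>up \<and>
         f \<in> Hm1p \<and> solution \<nu> \<sigma> f u \<and> u \<in> AsB s \<and>
         0 < \<theta> \<and> \<theta> < sqrt (\<alpha>lo / \<alpha>up) \<and>
         0 < \<mu> \<and> \<mu> \<le> 1 - \<alpha>up / \<alpha>lo * \<theta>\<^sup>2 \<and>
         0 \<le> tol \<and> tol < 1 \<and>
         adfour \<nu> \<sigma> f \<theta> tol \<Lambda> w r n \<and>
         \<not> (AE x in lebesgue_on Omega. w n x = u x)
         \<longrightarrow> real (card (\<Lambda> n)) \<le>
               C \<alpha>lo \<mu> \<rho> * H1_norm (\<lambda>x. u x - w n x) powr (- (real CARD('d) / s))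
                         * AsB_norm s u powr (real CARD('d) / s)"
proof -
  define p where "p = real CARD('d) / s"
  have p0: "p > 0" using assms by (simp add: p_def)
  define C :: "real \<Rightarrow> real \<Rightarrow> real \<Rightarrow> real" where
    "C = (\<lambda>_ \<mu> \<rho>. 2 * (\<rho> powr p / (1 - \<rho> powr p)) * (\<mu> * sqrt (1 - \<rho>\<^sup>2)) powr (- (p / 2)))"
  have bound: "real (card (\<Lambda> n)) \<le> C (min \<nu>lo \<sigma>lo) \<mu> \<rho> * H1_norm (\<lambda>x. u x - w n x) powr (- p) * AsB_norm s u powr p"
    if coeff: "coefficient \<nu> \<nu>lo \<nu>up" "coefficient \<sigma> \<sigma>lo \<sigma>up"
      and sol: "solution \<nu> \<sigma> f u" and u: "u \<in> AsB s"
      and \<theta>: "0 < \<theta>" "\<theta> < sqrt (min \<nu>lo \<sigma>lo / max \<nu>up \<sigma>up)"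
      and \<mu>: "0 < \<mu>" "\<mu> \<le> 1 - max \<nu>up \<sigma>up / min \<nu>lo \<sigma>lo * \<theta>\<^sup>2"
      and run: "adfour \<nu> \<sigma> f \<theta> tol \<Lambda> w r n"
      and ne: "\<not> (AE x in lebesgue_on Omega. w n x = u x)"
      and \<rho>_def: "\<rho> = sqrt (1 - min \<nu>lo \<sigma>lo / max \<nu>up \<sigma>up * \<theta>\<^sup>2)"
    for \<nu> \<sigma> :: "real^'d \<Rightarrow> real" and \<nu>lo \<nu>up \<sigma>lo \<sigma>up f u \<theta> \<mu> \<rho> tol \<Lambda> w r n
  proof -
    interpret elliptic_form \<nu> \<sigma> \<nu>lo \<nu>up \<sigma>lo \<sigma>up using coeff by unfold_locales
    define q where "q = \<alpha>lo / \<alpha>up"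
    have q: "0 < q" "q \<le> 1" using \<alpha>_bounds by (auto simp: q_def)
    have \<theta>q: "\<theta>\<^sup>2 < q"
      using \<theta> power_strict_mono[of \<theta> "sqrt q" 2] q by (simp add: q_def \<alpha>lo_def \<alpha>up_def)
    have \<rho>: "\<rho> = sqrt (1 - q * \<theta>\<^sup>2)" by (simp add: \<rho>_def q_def \<alpha>lo_def \<alpha>up_def)
    have q\<theta>: "0 < q * \<theta>\<^sup>2" "q * \<theta>\<^sup>2 < q\<^sup>2"
      using q \<theta>q \<theta> by (auto simp: power2_eq_square)
    have q1: "q\<^sup>2 \<le> 1" using q by (simp add: power_le_one)
    have \<rho>01: "0 < \<rho>" "\<rho> < 1" using q\<theta> q1 by (auto simp: \<rho>)
    have \<rho>2: "1 - \<rho>\<^sup>2 = q * \<theta>\<^sup>2" using q\<theta> q1 by (simp add: \<rho>)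
    have \<kappa>: "\<rho> powr p < 1" using \<rho>01 p0 by (intro powr_less_one_base) auto
    define e where "e = (\<lambda>x. u x - w n x)"
    have uH: "u \<in> H1p" using sol by (simp add: solution_def)
    have "w n \<in> H1p" using adfour_invariant[OF run sol order_refl] V_span_H1p by blast
    then have eH: "e \<in> H1p" unfolding e_def by (intro H1p_diff uH)
    have H: "H1sq e > 0"
    proof (rule ccontr)
      assume "\<not> H1sq e > 0"
      then have "H1sq e = 0" using H1sq_nonneg[of e] by linarith
      from H1sq_eq_0_imp_AE[OF eH this] have "AE x in lebesgue_on Omega. w n x = u x"
        by (rule eventually_mono) (simp add: e_def)
      with ne show False by simp
    qed
    have E: "\<alpha>lo * H1sq e \<le> energy e" "0 < \<alpha>lo * H1sq e" "0 < energy e"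
      using energy_bounds(1)[OF eH] H \<alpha>_bounds(1) by (auto intro: less_le_trans[OF mult_pos_pos])
    have M: "AsB_norm s u \<ge> 0" using H1_norm_nonneg[of u] H1_norm_le_AsB_norm[OF u] by linarith
    have "real (card (\<Lambda> n)) \<le> 2 * (AsB_norm s u * sqrt (\<alpha>up / \<mu>)) powr p * (\<rho> powr p / (1 - \<rho> powr p))
             * energy e powr (- (p / 2))"
      using cardinality_bound[OF run sol u assms \<theta>(1) \<mu>(1) _ p_def _ \<rho>01 order_refl] \<mu> E(3) \<rho>
      by (simp add: e_def \<alpha>lo_def \<alpha>up_def q_def)
    also have "\<dots> \<le> 2 * (AsB_norm s u * sqrt (\<alpha>up / \<mu>)) powr p * (\<rho> powr p / (1 - \<rho> powr p))
             * (\<alpha>lo * H1sq e) powr (- (p / 2))"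
      using E p0 \<kappa> by (intro mult_left_mono powr_mono2') auto
    also have "(AsB_norm s u * sqrt (\<alpha>up / \<mu>)) powr p = AsB_norm s u powr p * (\<mu> / \<alpha>up) powr (- (p / 2))"
    proof -
      have "sqrt (\<alpha>up / \<mu>) powr p = (\<alpha>up / \<mu>) powr (p / 2)"
        using \<alpha>_bounds(3) \<mu>(1) by (simp add: powr_half_sqrt[symmetric] powr_powr)
      also have "\<dots> = (\<mu> / \<alpha>up) powr (- (p / 2))"
        using \<alpha>_bounds(3) \<mu>(1) by (simp add: powr_divide powr_minus field_simps)
      finally show ?thesis using M \<alpha>_bounds(3) \<mu>(1) by (simp add: powr_mult)
    qed
    also have "(\<alpha>lo * H1sq e) powr (- (p / 2)) = \<alpha>lo powr (- (p / 2)) * H1_norm e powr (- p)"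
      using H \<alpha>_bounds(1) by (simp add: H1_norm_eq[OF eH] powr_mult powr_half_sqrt[symmetric] powr_powr)
    also have "2 * (AsB_norm s u powr p * (\<mu> / \<alpha>up) powr (- (p / 2))) * (\<rho> powr p / (1 - \<rho> powr p))
         * (\<alpha>lo powr (- (p / 2)) * H1_norm e powr (- p))
       = 2 * (\<rho> powr p / (1 - \<rho> powr p)) * (\<mu> * q) powr (- (p / 2)) * H1_norm e powr (- p) * AsB_norm s u powr p"
    proof -
      have "(\<mu> * q) powr (- (p / 2)) = (\<mu> / \<alpha>up) powr (- (p / 2)) * \<alpha>lo powr (- (p / 2))"
        using \<alpha>_bounds \<mu>(1) by (simp add: q_def flip: powr_mult)
      then show ?thesis by (simp only: mult_ac)
    qed
    also have "\<dots> \<le> C (min \<nu>lo \<sigma>lo) \<mu> \<rho> * H1_norm e powr (- p) * AsB_norm s u powr p"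
    proof -
      \<comment> \<open>The step that replaces \<open>\<alpha>lo/\<alpha>up\<close> by a function of \<open>\<rho>\<close>.\<close>
      have "sqrt (1 - \<rho>\<^sup>2) \<le> q" unfolding \<rho>2 using q\<theta>(2) q(1) by (intro real_le_lsqrt) auto
      moreover have "0 < sqrt (1 - \<rho>\<^sup>2)" unfolding \<rho>2 using q\<theta>(1) by simp
      ultimately have "(\<mu> * q) powr (- (p / 2)) \<le> (\<mu> * sqrt (1 - \<rho>\<^sup>2)) powr (- (p / 2))"
        using \<mu>(1) p0 by (intro powr_mono2') auto
      then show ?thesis unfolding C_def using \<kappa> by (intro mult_right_mono mult_left_mono) auto
    qed
    finally show ?thesis by (simp add: e_def)
  qed
  show ?thesis
    unfolding Let_def p_def[symmetric]
    by (rule exI[of _ C]) (use bound in blast)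
qed

end
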